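(* Let $A_1,\dots,A_m\in\mathbb{R}^{2\times2}$ be such that the subspaces $M(A_1),\dots,M(A_m)$ satisfy $M(A_j)\cap M(A_k)=\{0\}$ for $j\ne k$. Assume that $\sigma(A_j)\subset\mathbb{R}$ for each $j=1,\dots,m$ and that $\det[A_j,A_k]=0$ for all $1\le j<k\le m$. Let $l$ be the reduced length of $\{A_1,\dots,A_m\}$. If $l=3$, assume in addition that $\mathrm{Tr}(ABC-CBA)=0$ for all $A,B,C$ lying in a maximal reduction of $\{A_1,\dots,A_m\}$. Then $M(A_1)\cup\dots\cup M(A_m)\cup\mathbb{R}^2$ allows Carleman approximation in $\mathbb{C}^2$.
   Context: For $A\in\mathbb{R}^{2\times 2}$, $M(A):=(A+iI)\mathbb{R}^2\subset\mathbb{C}^2$, $\sigma(A)$ is the set of complex eigenvalues of $A$, and $[A,B]=AB-BA$. A sequence of real $2\times2$ matrices is reduced if there are no commuting pairs among its terms. A subsequence $\mathscr{B}$ of $\mathscr{A}=\{A_1,\dots,A_m\}$ is a reduction of $\mathscr{A}$ if $\mathscr{B}$ is reduced and is obtained from $\mathscr{A}$ by deleting some of its terms. The reduced length of $\mathscr{A}$ is the greatest positive integer $l$ such that there is a reduction of cardinality $l$; a maximal reduction is a reduction of cardinality $l$. A closed set $S\subset\mathbb{C}^2$ allows Carleman approximation if for every continuous $f:S\to\mathbb{C}$ and every strictly positive continuous $\epsilon:S\to\mathbb{R}$ there is an entire function $g\in\mathcal{O}(\mathbb{C}^2)$ with $|f(z)-g(z)|<\epsilon(z)$ for all $z\in S$.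 *)

theory Defs
  imports "HOL-Analysis.Analysis"
begin

definition cvec :: "real^2 \<Rightarrow> complex^2" where
  "cvec x = (\<chi> i. complex_of_real (x $ i))"

definition cmat :: "real^2^2 \<Rightarrow> complex^2^2" where
  "cmat A = map_matrix complex_of_real A"

definition real_plane :: "(complex^2) set" where
  "real_plane = range cvec"

definition M_space :: "real^2^2 \<Rightarrow> (complex^2) set" where
  "M_space A = (\<lambda>x. (cmat A + mat \<i>) *v cvec x) ` UNIV"

definition spec :: "real^2^2 \<Rightarrow> complex set" where
  "spec A = {\<mu>. \<exists>v. v \<noteq> 0 \<and> cmat A *v v = \<mu> *s v}"

definition commutator :: "real^2^2 \<Rightarrow> real^2^2 \<Rightarrow> real^2^2" where
  "commutator A B = A ** B - B ** A"

text \<open>A sequence \<open>A\<^sub>1, \<dots>, A\<^sub>m\<close> is a function on indices of which only the values on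
  \<open>{1..m}\<close> matter; a subsequence is given by the set \<open>I\<close> of the indices that are kept.
  Terms are compared by position, so a repeated matrix is a commuting pair.\<close>

definition reduced :: "(nat \<Rightarrow> real^2^2) \<Rightarrow> nat set \<Rightarrow> bool" where
  "reduced A I \<longleftrightarrow> (\<forall>j\<in>I. \<forall>k\<in>I. j \<noteq> k \<longrightarrow> commutator (A j) (A k) \<noteq> 0)"

definition is_reduction :: "(nat \<Rightarrow> real^2^2) \<Rightarrow> nat \<Rightarrow> nat set \<Rightarrow> bool" where
  "is_reduction A m I \<longleftrightarrow> I \<subseteq> {1..m} \<and> reduced A I"

definition reduced_length :: "(nat \<Rightarrow> real^2^2) \<Rightarrow> nat \<Rightarrow> nat" where
  "reduced_length A m = (GREATEST l. 0 < l \<and> (\<exists>I. is_reduction A m I \<and> card I = l))"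

definition maximal_reduction :: "(nat \<Rightarrow> real^2^2) \<Rightarrow> nat \<Rightarrow> nat set \<Rightarrow> bool" where
  "maximal_reduction A m I \<longleftrightarrow> is_reduction A m I \<and> card I = reduced_length A m"

text \<open>Holomorphic in several variables: real Frechet differentiable with a derivative that is
  complex homogeneous, hence complex linear.\<close>

definition entire :: "(complex^2 \<Rightarrow> complex) \<Rightarrow> bool" where
  "entire g \<longleftrightarrow>
     (\<forall>z. \<exists>D. (g has_derivative D) (at z) \<and> (\<forall>c v. D (c *s v) = c * D v))"

definition allows_Carleman_approximation :: "(complex^2) set \<Rightarrow> bool" where
  "allows_Carleman_approximation S \<longleftrightarrow> closed S \<and>
     (\<forall>(f :: complex^2 \<Rightarrow> complex) (\<epsilon> :: complex^2 \<Rightarrow> real).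
        continuous_on S f \<longrightarrow> continuous_on S \<epsilon> \<longrightarrow> (\<forall>z\<in>S. 0 < \<epsilon> z) \<longrightarrow>
        (\<exists>g. entire g \<and> (\<forall>z\<in>S. cmod (f z - g z) < \<epsilon> z)))"

end

theory Submission
  imports Defs "HOL-Complex_Analysis.Cauchy_Integral_Formula"
begin

text \<open>
  Two matrices with \<open>det [A, B] = 0\<close> share an eigenvector, and since the spectra are real it can be
  taken real. If no vector were an eigenvector of all of them, three of the
  matrices would have the pairs among three different lines as their eigenlines. Every
  other matrix would then commute with one of these three, so that the reduced length would be 3,
  while \<open>Tr (ABC - CBA) \<noteq> 0\<close> for these three matrices (lemma \<open>common_eigenvector\<close>). Hence all the
  matrices are simultaneously triangular over the reals, and after a linear change of coordinates
  the totally real planes, \<open>\<real>\<^sup>2\<close> among them, have the form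
  \<open>{(\<alpha>\<^sub>j s + \<beta>\<^sub>j t, \<delta>\<^sub>j t)}\<close> with real \<open>s\<close> and \<open>t\<close>. Transversality makes the lines \<open>\<alpha>\<^sub>j \<real>\<close> distinct, and
  the lines \<open>\<delta>\<^sub>j \<real>\<close> too.

  Because of the triangular form, planes can be separated by functions of one complex linear
  coordinate at a time. The second coordinate maps the planes into the distinct
  lines \<open>\<delta>\<^sub>j \<real>\<close>, which separates them away from the axis where it vanishes. Near that axis the
  coordinate \<open>s\<close> of the \<open>j\<close>-th plane is real on that plane, and it maps the others into strips of
  bounded width around other lines, hence into a disc and a sector that avoids the real line. In both
  cases the tool is an entire function of the coordinate which is close to 1 on the real line
  outside a disc, close to 0 on a smaller disc and on the sector, and bounded in between
  (\<open>entire_cutoff\<close>); it comes from narrow bumps \<open>1 / (1 + ((z - s) / \<eta>)\<^sup>2)\<close>, whose poles can be pushed to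
  infinity radially without meeting the sets in question. Multiplying it by an entire function which the
  Stone--Weierstrass theorem provides on a single plane gives approximation of functions that
  live on that plane and vanish near the origin.

  Together this approximates, on every large ball, a function that vanishes on the points of
  norm at most \<open>C r\<close> by an entire function that is small on the ball of radius \<open>r\<close>
  (\<open>approximation_away_from_origin\<close>). The corrections in the usual telescoping argument can
  therefore be chosen small on balls that exhaust \<open>\<complex>\<^sup>2\<close>, and their sum is entire
  (\<open>Carleman_approximation_if_local\<close>).
\<close>

section \<open>Entire functions of two complex variables\<close>

lemma norm_complex_scale:
  fixes v :: "complex^'n"
  shows "norm (c *s v) = cmod c * norm v"
  by (simp add: norm_vec_def norm_mult L2_set_right_distrib)

lemma entire_imp_continuous_on: "entire g \<Longrightarrow> continuous_on X g"
  unfolding entire_def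
  by (meson continuous_at_imp_continuous_on has_derivative_continuous)

lemma entire_const [simp]: "entire (\<lambda>p. c)"
  unfolding entire_def by (auto intro!: exI[of _ "\<lambda>_. 0"])

lemma entire_coord [simp]: "entire (\<lambda>p. p $ i)"
  unfolding entire_def
  by (auto intro!: exI[of _ "\<lambda>v. v $ i"] bounded_linear_imp_has_derivative bounded_linear_vec_nth)

lemma entire_add: "entire f \<Longrightarrow> entire g \<Longrightarrow> entire (\<lambda>p. f p + g p)"
  unfolding entire_def
proof
  fix z
  assume "\<forall>z. \<exists>D. (f has_derivative D) (at z) \<and> (\<forall>c v. D (c *s v) = c * D v)"
    "\<forall>z. \<exists>D. (g has_derivative D) (at z) \<and> (\<forall>c v. D (c *s v) = c * D v)"
  then obtain D E where "(f has_derivative D) (at z)" "\<forall>c v. D (c *s v) = c * D v"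
    "(g has_derivative E) (at z)" "\<forall>c v. E (c *s v) = c * E v" by meson
  then show "\<exists>D. ((\<lambda>p. f p + g p) has_derivative D) (at z) \<and> (\<forall>c v. D (c *s v) = c * D v)"
    by (intro exI[of _ "\<lambda>v. D v + E v"]) (auto intro!: derivative_eq_intros simp: algebra_simps)
qed

lemma entire_mult: "entire f \<Longrightarrow> entire g \<Longrightarrow> entire (\<lambda>p. f p * g p)"
  unfolding entire_def
proof
  fix z
  assume "\<forall>z. \<exists>D. (f has_derivative D) (at z) \<and> (\<forall>c v. D (c *s v) = c * D v)"
    "\<forall>z. \<exists>D. (g has_derivative D) (at z) \<and> (\<forall>c v. D (c *s v) = c * D v)"
  then obtain D E where "(f has_derivative D) (at z)" "\<forall>c v. D (c *s v) = c * D v"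
    "(g has_derivative E) (at z)" "\<forall>c v. E (c *s v) = c * E v" by meson
  then show "\<exists>D. ((\<lambda>p. f p * g p) has_derivative D) (at z) \<and> (\<forall>c v. D (c *s v) = c * D v)"
    by (intro exI[of _ "\<lambda>v. f z * E v + D v * g z"])
      (auto intro!: derivative_eq_intros simp: algebra_simps)
qed

lemma entire_diff: "entire f \<Longrightarrow> entire g \<Longrightarrow> entire (\<lambda>p. f p - g p)"
  using entire_add[of f "\<lambda>p. (-1) * g p"] entire_mult[of "\<lambda>p. -1" g] by simp

lemma entire_sum: "(\<And>i. i \<in> I \<Longrightarrow> entire (f i)) \<Longrightarrow> entire (\<lambda>p. \<Sum>i\<in>I. f i p)"
  by (induction I rule: infinite_finite_induct) (auto intro!: entire_add)

lemma entire_exp: 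
  assumes "entire f"
  shows "entire (\<lambda>p. exp (f p))"
  unfolding entire_def
proof
  fix z
  obtain D where "(f has_derivative D) (at z)" "\<forall>c v. D (c *s v) = c * D v"
    using assms unfolding entire_def by meson
  moreover from this have "((\<lambda>p. exp (f p)) has_derivative (\<lambda>v. exp (f z) * D v)) (at z)"
    by (auto intro: has_derivative_compose DERIV_exp[unfolded has_field_derivative_def])
  ultimately show "\<exists>D. ((\<lambda>p. exp (f p)) has_derivative D) (at z) \<and> (\<forall>c v. D (c *s v) = c * D v)"
    by (intro exI[of _ "\<lambda>v. exp (f z) * D v"]) simp
qed

lemma entire_compose_matrix:
  assumes "entire g"
  shows "entire (\<lambda>p. g (M *v p))"
  unfolding entire_def
proof
  fix z
  obtain D where D: "(g has_derivative D) (at (M *v z))" "\<forall>c v. D (c *s v) = c * D v"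
    using assms unfolding entire_def by meson
  have "((\<lambda>p. M *v p) has_derivative (\<lambda>p. M *v p)) (at z)"
  proof (rule bounded_linear_imp_has_derivative)
    have "linear ((*v) M)"
      by (rule linearI)
        (simp_all add: vec_eq_iff matrix_vector_mult_def sum.distrib algebra_simps scaleR_sum_right)
    then show "bounded_linear ((*v) M)"
      by (rule linear_conv_bounded_linear[THEN iffD1])
  qed
  then have "((\<lambda>p. g (M *v p)) has_derivative (\<lambda>v. D (M *v v))) (at z)"
    using D(1) by (rule has_derivative_compose)
  moreover have "D (M *v (c *s v)) = c * D (M *v v)" for c v
    using D(2) by (metis matrix_vector_mult_scaleR vector_scalar_commute)
  ultimately show "\<exists>D. ((\<lambda>p. g (M *v p)) has_derivative D) (at z) \<and> (\<forall>c v. D (c *s v) = c * D v)"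
    by blast
qed

text \<open>Cauchy's estimate on the complex line through \<open>z\<close> in the direction \<open>v\<close>. It is what makes locally
  uniform convergence of a series of entire functions pass to the derivatives.\<close>

lemma entire_derivative_bound:
  assumes "entire g" and D: "(g has_derivative D) (at z)" "\<And>c v. D (c *s v) = c * D v"
    and bd: "\<And>p. norm (p - z) \<le> 1 \<Longrightarrow> cmod (g p) \<le> B"
  shows "cmod (D v) \<le> B * norm v"
proof (cases "v = 0")
  case True
  then show ?thesis using D(2)[of 0 v] by simp
next
  case False
  \<comment> \<open>Normalizing the direction reduces the estimate to the unit disc of a single complex variable.\<close>
  define u where "u = complex_of_real (1 / norm v) *s v"
  have nu: "norm u = 1" using False by (simp add: u_def norm_complex_scale norm_divide)
  define \<phi> where "\<phi> t = g (z + t *s u)" for t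
  have lin: "((\<lambda>t. z + t *s u) has_derivative (\<lambda>t. t *s u)) (at t)" for t :: complex
  proof -
    have "linear (\<lambda>t::complex. t *s u)"
      by (rule linearI) (simp_all add: vec_eq_iff algebra_simps)
    then have "bounded_linear (\<lambda>t::complex. t *s u)"
      by (rule linear_conv_bounded_linear[THEN iffD1])
    then show ?thesis
      by (auto intro!: derivative_eq_intros bounded_linear_imp_has_derivative)
  qed
  have der: "(\<phi> has_field_derivative E u) (at t)"
    if "(g has_derivative E) (at (z + t *s u))" "\<And>c v. E (c *s v) = c * E v" for t E
  proof -
    have "((\<lambda>t. g (z + t *s u)) has_derivative (\<lambda>t. E (t *s u))) (at t)"
      using lin that(1) by (rule has_derivative_compose)
    moreover have "(\<lambda>t. E (t *s u)) = (*) (E u)"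
      by (simp add: that(2) fun_eq_iff mult.commute)
    ultimately show ?thesis
      unfolding \<phi>_def has_field_derivative_def by simp
  qed
  have hol: "\<phi> holomorphic_on UNIV"
    unfolding holomorphic_on_def field_differentiable_def
    using der \<open>entire g\<close> unfolding entire_def by (metis UNIV_I)
  have "(\<phi> has_field_derivative D u) (at 0)"
    using der[of D 0] D by simp
  then have "deriv \<phi> 0 = D u" by (rule DERIV_imp_deriv)
  moreover have "cmod ((deriv ^^ 1) \<phi> 0) \<le> fact 1 * B / 1 ^ 1"
  proof (rule Cauchy_inequality)
    show "continuous_on (cball 0 1) \<phi>"
      using hol holomorphic_on_imp_continuous_on continuous_on_subset by blast
    show "cmod (\<phi> t) \<le> B" if "cmod (0 - t) = 1" for t
      unfolding \<phi>_def using that nu by (intro bd) (simp add: norm_complex_scale)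
  qed (use hol holomorphic_on_subset in auto)
  ultimately have "cmod (D u) \<le> B" by simp
  moreover have "D u = complex_of_real (1 / norm v) * D v" by (simp add: u_def D(2))
  ultimately show ?thesis using False
    by (simp add: norm_mult norm_divide divide_simps mult.commute)
qed

text \<open>The balls on which the \<open>n\<close>-th term is controlled grow geometrically, so every bounded set lies well
  inside all but finitely many of them; there the derivatives converge uniformly as well.\<close>

lemma entire_series:
  fixes g :: "nat \<Rightarrow> complex^2 \<Rightarrow> complex"
  assumes ent: "\<And>n. entire (g n)" and "c > 0"
    and bd: "\<And>n p. norm p \<le> c * 2 ^ n \<Longrightarrow> cmod (g n p) \<le> M * (1/2) ^ n"
  shows "entire (\<lambda>p. \<Sum>n. g n p)" "\<And>p. summable (\<lambda>n. g n p)"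
proof -
  have geo: "summable (\<lambda>n. M * (1/2) ^ n)" for M :: real
    by (intro summable_mult summable_geometric) simp
  have big: "\<forall>\<^sub>F n in sequentially. R \<le> c * 2 ^ n" for R
  proof -
    obtain N where "R / c < 2 ^ N" using real_arch_pow[of 2 "R / c"] by auto
    then have "R < c * 2 ^ N" using \<open>c > 0\<close> by (simp add: field_simps)
    moreover have "c * 2 ^ N \<le> c * 2 ^ n" if "N \<le> n" for n
      using that \<open>c > 0\<close> by (intro mult_left_mono power_increasing) auto
    ultimately show ?thesis by (intro eventually_sequentiallyI[of N]) fastforce
  qed
  show sm: "summable (\<lambda>n. g n p)" for p
    by (rule summable_comparison_test_ev[OF _ geo[of M]])
      (rule eventually_mono[OF big[of "norm p"]], rule bd)
  have "\<exists>D. \<forall>v. (g n has_derivative D z) (at z) \<and> (\<forall>c v. D z (c *s v) = c * D z v)" for n z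
    using ent[of n] unfolding entire_def by metis
  then obtain D where D: "\<And>n z. (g n has_derivative D n z) (at z)"
      "\<And>n z c v. D n z (c *s v) = c * D n z v" 
    using ent unfolding entire_def by metis
  have Dbd: "cmod (D n z v) \<le> M * (1/2) ^ n * norm v" if "norm z + 1 \<le> c * 2 ^ n" for n z v
  proof (rule entire_derivative_bound[OF ent D])
    fix p assume "norm (p - z) \<le> 1"
    then have "norm p \<le> norm z + 1" using norm_triangle_sub[of p z] by simp
    then show "cmod (g n p) \<le> M * (1/2) ^ n" using that by (intro bd) simp
  qed
  define G where "G z v = (\<Sum>n. D n z v)" for z v
  have smD: "summable (\<lambda>n. D n z v)" for z v
    by (rule summable_comparison_test_ev[OF _ geo[of "M * norm v"]])
      (rule eventually_mono[OF big[of "norm z + 1"]], use Dbd in \<open>simp add: mult_ac\<close>)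
  show "entire (\<lambda>p. \<Sum>n. g n p)"
    unfolding entire_def
  proof
    fix z :: "complex^2"
    define S where "S = ball z 1"
    have "\<exists>h. \<forall>x\<in>S. (\<lambda>n. g n x) sums h x \<and> (h has_derivative G x) (at x within S)"
    proof (rule has_derivative_series)
      show "convex S" "z \<in> S" by (auto simp: S_def)
      show "(g n has_derivative D n x) (at x within S)" for n x
        using D(1) by (rule has_derivative_at_withinI)
      show "(\<lambda>n. g n z) sums (\<Sum>n. g n z)" using sm by (rule summable_sums)
      fix e :: real assume "e > 0"
      have "(\<lambda>n. 2 * M * (1/2::real) ^ n) \<longlonglongrightarrow> 0"
        by (intro tendsto_mult_right_zero LIMSEQ_realpow_zero) auto
      then have "\<forall>\<^sub>F n in sequentially. 2 * M * (1/2) ^ n < e"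
        using \<open>e > 0\<close> by (rule order_tendstoD)
      moreover have "\<forall>\<^sub>F n in sequentially. \<forall>m\<ge>n. norm z + 2 \<le> c * 2 ^ m"
        using big by (rule eventually_all_ge_at_top)
      ultimately show "\<forall>\<^sub>F n in sequentially. \<forall>x\<in>S. \<forall>h. cmod ((\<Sum>i<n. D i x h) - G x h) \<le> e * norm h"
      proof eventually_elim
        case (elim n)
        show ?case
        proof (intro ballI allI)
          fix x h assume "x \<in> S"
          then have "norm x \<le> norm z + 1"
            using norm_triangle_sub[of x z] by (simp add: S_def dist_norm norm_minus_commute)
          then have bdn: "cmod (D (i + n) x h) \<le> (M * norm h * (1/2) ^ n) * (1/2) ^ i" for i
            using Dbd[of x "i + n" h] elim(2)[rule_format, of "i + n"] by (simp add: power_add mult_ac)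
          have "G x h - (\<Sum>i<n. D i x h) = (\<Sum>i. D (i + n) x h)"
            unfolding G_def using smD by (subst suminf_split_initial_segment[of _ n]) auto
          also have "cmod \<dots> \<le> (\<Sum>i. (M * norm h * (1/2) ^ n) * (1/2) ^ i)"
            by (rule norm_suminf_le[OF bdn geo])
          also have "\<dots> = 2 * M * (1/2) ^ n * norm h"
            by (subst suminf_mult) (auto simp: suminf_geometric)
          also have "\<dots> \<le> e * norm h" using elim(1) by (intro mult_right_mono) auto
          finally show "cmod ((\<Sum>i<n. D i x h) - G x h) \<le> e * norm h"
            by (simp add: norm_minus_commute)
        qed
      qed
    qed
    then obtain h where h: "\<And>x. x \<in> S \<Longrightarrow> (\<lambda>n. g n x) sums h x"
      "\<And>x. x \<in> S \<Longrightarrow> (h has_derivative G x) (at x within S)" by blast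
    have z: "z \<in> S" "open S" by (auto simp: S_def)
    have "(h has_derivative G z) (at z)"
      using h(2)[OF z(1)] by (simp add: at_within_open[OF z])
    then have "((\<lambda>p. \<Sum>n. g n p) has_derivative G z) (at z)"
      by (rule has_derivative_transform_within_open[OF _ z(2,1)])
        (use h(1) sums_unique in blast)
    moreover have "G z (c *s v) = c * G z v" for c v
      unfolding G_def by (simp add: D(2) suminf_mult smD)
    ultimately show "\<exists>D. ((\<lambda>p. \<Sum>n. g n p) has_derivative D) (at z) \<and>
        (\<forall>c v. D (c *s v) = c * D v)" by blast
  qed
qed

section \<open>Uniform approximation by entire functions\<close>

definition entire_approximable :: "(complex^2) set \<Rightarrow> (complex^2 \<Rightarrow> complex) \<Rightarrow> bool" where
  "entire_approximable X f \<longleftrightarrow> (\<forall>e>0. \<exists>g. entire g \<and> (\<forall>p\<in>X. cmod (f p - g p) < e))"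

lemma entire_approximableD:
  assumes "entire_approximable X f" "e > 0"
  obtains g where "entire g" "\<And>p. p \<in> X \<Longrightarrow> cmod (f p - g p) < e"
  using assms unfolding entire_approximable_def by blast

lemma entire_imp_approximable: "entire f \<Longrightarrow> entire_approximable X f"
  unfolding entire_approximable_def by auto

lemma entire_approximable_cong:
  assumes "entire_approximable X f" "\<And>p. p \<in> X \<Longrightarrow> f p = g p"
  shows "entire_approximable X g"
  unfolding entire_approximable_def
proof (intro allI impI)
  fix e :: real assume "e > 0"
  then obtain h where "entire h" "\<And>p. p \<in> X \<Longrightarrow> cmod (f p - h p) < e"
    using entire_approximableD[OF assms(1)] by blast
  then show "\<exists>h. entire h \<and> (\<forall>p\<in>X. cmod (g p - h p) < e)"
    using assms(2) by (intro exI[of _ h]) simp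
qed

lemma entire_approximable_add:
  assumes "entire_approximable X f" "entire_approximable X g"
  shows "entire_approximable X (\<lambda>p. f p + g p)"
  unfolding entire_approximable_def
proof (intro allI impI)
  fix e :: real assume "e > 0"
  obtain f' where f': "entire f'" "\<And>p. p \<in> X \<Longrightarrow> cmod (f p - f' p) < e/2"
    using entire_approximableD[OF assms(1), of "e/2"] \<open>e > 0\<close> by auto
  obtain g' where g': "entire g'" "\<And>p. p \<in> X \<Longrightarrow> cmod (g p - g' p) < e/2"
    using entire_approximableD[OF assms(2), of "e/2"] \<open>e > 0\<close> by auto
  have "cmod (f p + g p - (f' p + g' p)) < e" if "p \<in> X" for p
    using norm_triangle_ineq[of "f p - f' p" "g p - g' p"] f'(2)[OF that] g'(2)[OF that]
    by (simp add: algebra_simps)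
  then show "\<exists>h. entire h \<and> (\<forall>p\<in>X. cmod (f p + g p - h p) < e)"
    using entire_add[OF f'(1) g'(1)] by blast
qed

lemma entire_approximable_sum:
  assumes "\<And>i. i \<in> I \<Longrightarrow> entire_approximable X (f i)"
  shows "entire_approximable X (\<lambda>p. \<Sum>i\<in>I. f i p)"
  using assms
proof (induction I rule: infinite_finite_induct)
  case (infinite I)
  then show ?case unfolding sum.infinite[OF infinite(1)] by (intro entire_imp_approximable entire_const)
next
  case empty
  then show ?case unfolding sum.empty by (intro entire_imp_approximable entire_const)
next
  case (insert i I)
  then show ?case using entire_approximable_add[of X "f i" "\<lambda>p. \<Sum>i\<in>I. f i p"] by simp
qed

lemma entire_approximable_mult:
  assumes f: "entire_approximable X f" "\<And>p. p \<in> X \<Longrightarrow> cmod (f p) \<le> B"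
    and g: "entire_approximable X g" "\<And>p. p \<in> X \<Longrightarrow> cmod (g p) \<le> C"
  shows "entire_approximable X (\<lambda>p. f p * g p)"
  unfolding entire_approximable_def
proof (intro allI impI)
  fix e :: real assume "e > 0"
  define K where "K = \<bar>B\<bar> + \<bar>C\<bar> + 1"
  have "K > 0" by (simp add: K_def)
  define d where "d = min 1 (e / (2 * K))"
  have "d > 0" using \<open>e > 0\<close> \<open>K > 0\<close> by (simp add: d_def)
  obtain f' where f': "entire f'" "\<And>p. p \<in> X \<Longrightarrow> cmod (f p - f' p) < d"
    using entire_approximableD[OF f(1) \<open>d > 0\<close>] by blast
  obtain g' where g': "entire g'" "\<And>p. p \<in> X \<Longrightarrow> cmod (g p - g' p) < d"
    using entire_approximableD[OF g(1) \<open>d > 0\<close>] by blast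
  have "cmod (f p * g p - f' p * g' p) < e" if p: "p \<in> X" for p
  proof -
    have "cmod (f' p) \<le> cmod (f p) + cmod (f' p - f p)" by (metis norm_triangle_sub)
    also have "\<dots> \<le> \<bar>B\<bar> + 1"
      using f(2)[OF p] f'(2)[OF p] unfolding d_def norm_minus_commute[of "f' p"] by linarith
    finally have 1: "cmod (f' p) \<le> K" by (simp add: K_def)
    have 2: "cmod (g p) \<le> K" using g(2)[OF p] by (simp add: K_def)
    have "f p * g p - f' p * g' p = (f p - f' p) * g p + f' p * (g p - g' p)"
      by (simp add: algebra_simps)
    then have "cmod (f p * g p - f' p * g' p) \<le> cmod (f p - f' p) * cmod (g p) + cmod (f' p) * cmod (g p - g' p)"
      by (metis norm_mult norm_triangle_ineq)
    also have "\<dots> \<le> cmod (f p - f' p) * K + K * cmod (g p - g' p)"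
      using 1 2 by (intro add_mono mult_left_mono mult_right_mono) auto
    also have "\<dots> < d * K + K * d"
      using f'(2)[OF p] g'(2)[OF p] \<open>K > 0\<close> by (intro add_strict_mono) auto
    also have "\<dots> \<le> e" using \<open>K > 0\<close> by (simp add: d_def min_def field_simps)
    finally show ?thesis .
  qed
  then show "\<exists>h. entire h \<and> (\<forall>p\<in>X. cmod (f p * g p - h p) < e)"
    using entire_mult[OF f'(1) g'(1)] by blast
qed

lemma entire_approximable_limit:
  assumes "\<And>e. e > 0 \<Longrightarrow> \<exists>g. entire_approximable X g \<and> (\<forall>p\<in>X. cmod (f p - g p) < e)"
  shows "entire_approximable X f"
  unfolding entire_approximable_def
proof (intro allI impI)
  fix e :: real assume "e > 0"
  then obtain g where g: "entire_approximable X g" "\<And>p. p \<in> X \<Longrightarrow> cmod (f p - g p) < e/2"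
    using assms[of "e/2"] by auto
  obtain h where h: "entire h" "\<And>p. p \<in> X \<Longrightarrow> cmod (g p - h p) < e/2"
    using entire_approximableD[OF g(1), of "e/2"] \<open>e > 0\<close> by auto
  have "cmod (f p - h p) < e" if "p \<in> X" for p
    using norm_triangle_ineq[of "f p - g p" "g p - h p"] g(2)[OF that] h(2)[OF that] by simp
  then show "\<exists>h. entire h \<and> (\<forall>p\<in>X. cmod (f p - h p) < e)" using h(1) by blast
qed

lemma entire_approximable_inverse_near_1:
  assumes f: "entire_approximable X f" "\<And>p. p \<in> X \<Longrightarrow> cmod (f p) \<le> 1/2"
  shows "entire_approximable X (\<lambda>p. 1 / (1 - f p))"
proof (rule entire_approximable_limit)
  fix e :: real assume "e > 0"
  have pow: "entire_approximable X (\<lambda>p. f p ^ n)" for n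
  proof (induction n)
    case (Suc n)
    have "cmod (f p ^ n) \<le> (1/2) ^ n" if "p \<in> X" for p
      unfolding norm_power by (rule power_mono) (use f(2) that in auto)
    then show ?case
      unfolding power_Suc using f Suc by (rule entire_approximable_mult[rotated 3])
  qed (simp add: entire_imp_approximable[OF entire_const])
  obtain n where n: "(1/2::real) ^ n < e/2"
    using real_arch_pow_inv[of "e/2" "1/2"] \<open>e > 0\<close> by auto
  have "cmod (1 / (1 - f p) - (\<Sum>k<n. f p ^ k)) < e" if "p \<in> X" for p
  proof -
    have fp: "cmod (f p) \<le> 1/2" using f(2) that by blast
    then have ne: "f p \<noteq> 1" by auto
    have "1 - cmod (f p) \<le> cmod (1 - f p)" using norm_triangle_ineq2[of 1 "f p"] by simp
    then have lb: "1/2 \<le> cmod (1 - f p)" using fp by linarith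
    have "1 / (1 - f p) - (\<Sum>k<n. f p ^ k) = f p ^ n / (1 - f p)"
      using ne by (simp add: sum_gp_strict diff_divide_distrib)
    then have "cmod (1 / (1 - f p) - (\<Sum>k<n. f p ^ k)) = cmod (f p) ^ n / cmod (1 - f p)"
      by (simp add: norm_divide norm_power)
    also have "\<dots> \<le> (1/2) ^ n / (1/2)"
      using fp lb by (intro frac_le power_mono) auto
    also have "\<dots> < e" using n by simp
    finally show ?thesis .
  qed
  then show "\<exists>g. entire_approximable X g \<and> (\<forall>p\<in>X. cmod (1 / (1 - f p) - g p) < e)"
    by (intro exI[of _ "\<lambda>p. \<Sum>k<n. f p ^ k"] conjI ballI entire_approximable_sum pow)
qed

text \<open>A form of Runge's theorem: the pole of \<open>1 / (1 - c f)\<close> is moved from infinity to its final position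
  while \<open>c\<close> grows from 0 to 1. Since the denominators are uniformly bounded away from 0 on the compact
  set \<open>X\<close>, finitely many steps suffice, and each step is a geometric series in a small function.\<close>

lemma entire_approximable_inverse:
  assumes "compact X" "entire f"
    and ne: "\<And>c p. \<lbrakk>0 \<le> c; c \<le> 1; p \<in> X\<rbrakk> \<Longrightarrow> complex_of_real c * f p \<noteq> 1"
  shows "entire_approximable X (\<lambda>p. 1 / (1 - f p))"
proof (cases "X = {}")
  case True
  then show ?thesis
    by (intro entire_approximable_cong[OF entire_imp_approximable[OF entire_const[of 0]]]) auto
next
  case False
  have contf: "continuous_on X f" using entire_imp_continuous_on[OF \<open>entire f\<close>] .
  obtain B where B: "B > 0" "\<And>p. p \<in> X \<Longrightarrow> cmod (f p) \<le> B"
    using compact_imp_bounded[OF compact_continuous_image[OF contf \<open>compact X\<close>]]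
    by (auto simp: bounded_pos)
  have "continuous_on ({0..1} \<times> X) (\<lambda>(c, p). cmod (1 - complex_of_real c * f p))"
    unfolding case_prod_unfold
    by (intro continuous_intros continuous_on_compose2[OF contf]) auto
  moreover have "compact ({0..1::real} \<times> X)" "{0..1::real} \<times> X \<noteq> {}"
    using compact_Times[OF compact_Icc \<open>compact X\<close>] False by auto
  ultimately obtain cp0 where cp0: "cp0 \<in> {0..1::real} \<times> X"
    and min0: "\<forall>cp\<in>{0..1} \<times> X. (\<lambda>(c, p). cmod (1 - complex_of_real c * f p)) cp0
      \<le> (\<lambda>(c, p). cmod (1 - complex_of_real c * f p)) cp"
    using continuous_attains_inf[of "{0..1} \<times> X"] by blast
  obtain c0 p0 where "cp0 = (c0, p0)" by fastforce
  then have cp: "c0 \<in> {0..1::real}" "p0 \<in> X"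
    and min: "\<And>c p. \<lbrakk>c \<in> {0..1}; p \<in> X\<rbrakk> \<Longrightarrow>
      cmod (1 - complex_of_real c0 * f p0) \<le> cmod (1 - complex_of_real c * f p)"
    using cp0 min0 by auto
  define \<mu> where "\<mu> = cmod (1 - complex_of_real c0 * f p0)"
  have "\<mu> > 0" using ne[of c0 p0] cp by (auto simp: \<mu>_def)
  obtain n :: nat where n: "2 * B / \<mu> + 1 \<le> n" using real_arch_simple by blast
  then have "0 < real n" using \<open>B > 0\<close> \<open>\<mu> > 0\<close> by (smt (verit) divide_pos_pos)
  then have n: "n > 0" "2 * B / \<mu> \<le> n" using n by auto
  have "entire_approximable X (\<lambda>p. 1 / (1 - complex_of_real (k / n) * f p))" if "k \<le> n" for k :: nat
    using that
  proof (induction k)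
    case 0
    then show ?case by (simp add: entire_imp_approximable[OF entire_const])
  next
    case (Suc k)
    define F where "F p = 1 / (1 - complex_of_real (k / n) * f p)" for p
    have kn: "real k / n \<in> {0..1}" "real (Suc k) / n \<in> {0..1}" using Suc.prems by auto
    have F: "entire_approximable X F" using Suc unfolding F_def by simp
    have Fb: "cmod (F p) \<le> 1 / \<mu>" if "p \<in> X" for p
      using min[OF kn(1) that] \<open>\<mu> > 0\<close> unfolding F_def \<mu>_def[symmetric]
      by (simp add: norm_divide divide_simps)
    have u: "cmod (complex_of_real (1/n) * f p * F p) \<le> 1/2" if "p \<in> X" for p
    proof -
      have "cmod (complex_of_real (1/n) * f p * F p) \<le> (1/n * B) * (1/\<mu>)"
        unfolding norm_mult using Fb[OF that] B(2)[OF that] \<open>B > 0\<close>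
        by (intro mult_mono) (auto simp: norm_divide divide_simps)
      also have "\<dots> \<le> 1/2" using n \<open>\<mu> > 0\<close> by (simp add: field_simps)
      finally show ?thesis .
    qed
    have uf: "entire_approximable X (\<lambda>p. complex_of_real (1/n) * f p * F p)"
    proof (rule entire_approximable_mult[OF _ _ F Fb])
      show "entire_approximable X (\<lambda>p. complex_of_real (1/n) * f p)"
        by (intro entire_imp_approximable entire_mult entire_const \<open>entire f\<close>)
      show "cmod (complex_of_real (1/n) * f p) \<le> 1/n * B" if "p \<in> X" for p
        using B(2)[OF that] by (simp add: norm_mult norm_divide divide_right_mono)
    qed
    have "entire_approximable X (\<lambda>p. F p * (1 / (1 - complex_of_real (1/n) * f p * F p)))"
    proof (rule entire_approximable_mult[where B = "1/\<mu>" and C = 2])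
      show "cmod (1 / (1 - complex_of_real (1/n) * f p * F p)) \<le> 2" if "p \<in> X" for p
      proof -
        have "1 - 1/2 \<le> cmod (1 - complex_of_real (1/n) * f p * F p)"
          using u[OF that] norm_triangle_ineq2[of 1 "complex_of_real (1/n) * f p * F p"] by simp
        then have "1 / cmod (1 - complex_of_real (1/n) * f p * F p) \<le> 1 / (1/2)"
          by (intro divide_left_mono) auto
        then show ?thesis by (simp add: norm_divide)
      qed
    qed (use F Fb entire_approximable_inverse_near_1[OF uf u] in auto)
    moreover have "F p * (1 / (1 - complex_of_real (1/n) * f p * F p)) =
        1 / (1 - complex_of_real (Suc k / n) * f p)" if "p \<in> X" for p
    proof -
      have "1 - complex_of_real (k / n) * f p \<noteq> 0"
        using ne[of "k/n" p] kn(1) that by auto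
      moreover have "a * (1 - d * (1 / a)) = a - d" if "a \<noteq> 0" for a d :: complex
        using that by (simp add: right_diff_distrib)
      ultimately have "(1 - complex_of_real (k / n) * f p) * (1 - complex_of_real (1/n) * f p * F p)
          = 1 - complex_of_real (k / n) * f p - complex_of_real (1/n) * f p"
        unfolding F_def by blast
      also have "\<dots> = 1 - complex_of_real (Suc k / n) * f p"
        by (simp add: add_divide_distrib algebra_simps)
      finally show ?thesis unfolding F_def by (metis divide_divide_eq_left mult.right_neutral
            times_divide_eq_right)
    qed
    ultimately show ?case by (rule entire_approximable_cong)
  qed
  from this[of n] n show ?thesis by simp
qed

section \<open>Cutoff functions in one complex coordinate\<close>

text \<open>The bump has the two poles \<open>l = s \<plusminus> i \<eta>\<close>. Moving them to infinity along rays from the origin never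
  meets \<open>l ` X\<close>: the rays are nonreal, start outside the disc, and are so flat (slope \<open>\<eta> / \<bar>s\<bar> < \<kappa>\<close>) that
  they miss the sector \<open>\<kappa> \<bar>Re\<bar> \<le> \<bar>Im\<bar>\<close>.\<close>

lemma entire_approximable_cauchy_bump:
  assumes "compact X" "entire l" and "s \<noteq> 0" "\<eta> > 0" "\<kappa> > 0" "\<eta> < \<kappa> * \<bar>s\<bar>"
    and geo: "\<And>p. p \<in> X \<Longrightarrow> l p \<in> \<real> \<or> cmod (l p) < \<bar>s\<bar> \<or> \<kappa> * \<bar>Re (l p)\<bar> \<le> \<bar>Im (l p)\<bar>"
  shows "entire_approximable X (\<lambda>p. 1 / (1 + ((l p - complex_of_real s) / complex_of_real \<eta>)\<^sup>2))"
proof -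
  have contl: "continuous_on X l" using entire_imp_continuous_on[OF \<open>entire l\<close>] .
  have factor: "entire_approximable X (\<lambda>p. 1 / (1 - l p / \<zeta>))"
      and bounded_factor: "\<exists>B. \<forall>p\<in>X. cmod (1 / (1 - l p / \<zeta>)) \<le> B"
    if \<zeta>: "Re \<zeta> = s" "\<bar>Im \<zeta>\<bar> = \<eta>" for \<zeta>
  proof -
    have z0: "\<zeta> \<noteq> 0" using \<zeta> \<open>s \<noteq> 0\<close> by auto
    have avoid: "complex_of_real c * (l p / \<zeta>) \<noteq> 1" if "0 \<le> c" "c \<le> 1" "p \<in> X" for c p
    proof
      assume "complex_of_real c * (l p / \<zeta>) = 1"
      then have eq: "complex_of_real c * l p = \<zeta>" using z0 by (simp add: field_simps)
      then have re: "c * Re (l p) = s" and im: "\<bar>c * Im (l p)\<bar> = \<eta>" using \<zeta> by auto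
      have norm: "c * cmod (l p) = cmod \<zeta>" 
        using eq \<open>0 \<le> c\<close> by (metis abs_of_nonneg norm_mult norm_of_real)
      from geo[OF \<open>p \<in> X\<close>] show False
      proof (elim disjE)
        assume "l p \<in> \<real>"
        then show False using im \<open>\<eta> > 0\<close> by (auto simp: complex_is_Real_iff)
      next
        assume "cmod (l p) < \<bar>s\<bar>"
        moreover have "c * cmod (l p) \<le> 1 * cmod (l p)" using that by (intro mult_right_mono) auto
        moreover have "\<bar>s\<bar> \<le> cmod \<zeta>" using \<zeta> abs_Re_le_cmod[of \<zeta>] by simp
        ultimately show False using norm by simp
      next
        assume "\<kappa> * \<bar>Re (l p)\<bar> \<le> \<bar>Im (l p)\<bar>"
        then have "c * (\<kappa> * \<bar>Re (l p)\<bar>) \<le> c * \<bar>Im (l p)\<bar>" using \<open>0 \<le> c\<close> by (rule mult_left_mono)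
        moreover have "c * (\<kappa> * \<bar>Re (l p)\<bar>) = \<kappa> * \<bar>s\<bar>"
          using re \<open>0 \<le> c\<close> by (simp add: abs_mult flip: re)
        moreover have "c * \<bar>Im (l p)\<bar> = \<eta>" using im \<open>0 \<le> c\<close> by (simp add: abs_mult)
        ultimately show False using \<open>\<eta> < \<kappa> * \<bar>s\<bar>\<close> by simp
      qed
    qed
    have ent: "entire (\<lambda>p. l p / \<zeta>)"
      using entire_mult[OF \<open>entire l\<close> entire_const[of "1/\<zeta>"]] by simp
    show "entire_approximable X (\<lambda>p. 1 / (1 - l p / \<zeta>))"
      by (rule entire_approximable_inverse[OF \<open>compact X\<close> ent avoid])
    have "continuous_on X (\<lambda>p. 1 / (1 - l p / \<zeta>))"
      using avoid[of 1] z0 by (intro continuous_intros contl) auto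
    then have "bounded ((\<lambda>p. 1 / (1 - l p / \<zeta>)) ` X)"
      by (intro compact_imp_bounded compact_continuous_image \<open>compact X\<close>)
    then show "\<exists>B. \<forall>p\<in>X. cmod (1 / (1 - l p / \<zeta>)) \<le> B"
      unfolding bounded_iff by auto
  qed
  define \<zeta> where "\<zeta> = Complex s \<eta>"
  have z: "Re \<zeta> = s" "\<bar>Im \<zeta>\<bar> = \<eta>" "Re (cnj \<zeta>) = s" "\<bar>Im (cnj \<zeta>)\<bar> = \<eta>"
    using \<open>\<eta> > 0\<close> by (auto simp: \<zeta>_def)
  obtain B C where BC: "\<forall>p\<in>X. cmod (1 / (1 - l p / \<zeta>)) \<le> B" "\<forall>p\<in>X. cmod (1 / (1 - l p / cnj \<zeta>)) \<le> C"
    using bounded_factor[OF z(1,2)] bounded_factor[OF z(3,4)] by blast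
  define K where "K = complex_of_real (\<eta>\<^sup>2 / (s\<^sup>2 + \<eta>\<^sup>2))"
  have "entire_approximable X (\<lambda>p. 1 / (1 - l p / \<zeta>) * (1 / (1 - l p / cnj \<zeta>)))"
    using entire_approximable_mult[OF factor[OF z(1,2)] _ factor[OF z(3,4)], of B C] BC by blast
  then have "entire_approximable X (\<lambda>p. K * (1 / (1 - l p / \<zeta>) * (1 / (1 - l p / cnj \<zeta>))))"
    by (rule entire_approximable_mult[OF entire_imp_approximable[OF entire_const], rotated,
        where B = "cmod K" and C = "B * C"])
      (use BC in \<open>auto simp only: norm_mult intro!: mult_mono\<close>,
       auto intro: order_trans[OF norm_ge_zero])
  then show ?thesis
  proof (rule entire_approximable_cong)
    fix p
    have s0: "complex_of_real s ^ 2 + complex_of_real \<eta> ^ 2 = \<zeta> * cnj \<zeta>"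
      by (simp add: \<zeta>_def complex_eq_iff power2_eq_square)
    have z0: "\<zeta> \<noteq> 0" using z \<open>s \<noteq> 0\<close> by auto
    have 1: "(\<zeta> - l p) * (cnj \<zeta> - l p) = (l p - complex_of_real s)\<^sup>2 + complex_of_real \<eta> ^ 2"
      by (simp add: \<zeta>_def complex_eq_iff power2_eq_square algebra_simps)
    have "K * (1 / (1 - l p / \<zeta>) * (1 / (1 - l p / cnj \<zeta>)))
        = complex_of_real \<eta> ^ 2 / (\<zeta> * cnj \<zeta>) * ((\<zeta> * cnj \<zeta>) / ((\<zeta> - l p) * (cnj \<zeta> - l p)))"
      using z0 by (simp add: K_def s0 divide_simps)
    also have "\<dots> = complex_of_real \<eta> ^ 2 / ((l p - complex_of_real s)\<^sup>2 + complex_of_real \<eta> ^ 2)"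
      unfolding 1 using z0 by simp
    also have "\<dots> = 1 / (1 + ((l p - complex_of_real s) / complex_of_real \<eta>)\<^sup>2)"
      using \<open>\<eta> > 0\<close> by (simp add: power_divide divide_simps add.commute)
    finally show "K * (1 / (1 - l p / \<zeta>) * (1 / (1 - l p / cnj \<zeta>)))
        = 1 / (1 + ((l p - complex_of_real s) / complex_of_real \<eta>)\<^sup>2)" .
  qed
qed


text \<open>A sum \<open>E\<close> of bumps, centred at real points spaced by their width \<open>\<eta>\<close>, is nonnegative on the real
  line and at least \<open>1/2\<close> at the real values of \<open>l\<close> on \<open>X\<close> beyond \<open>2 \<rho>\<close>. On the disc and the sector, which have distance at least
  \<open>d = \<kappa> \<rho> / 2\<close> from the centres, each bump is of order \<open>\<eta>\<^sup>2\<close>; as there are only about \<open>1 / \<eta>\<close> of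
  them, \<open>E\<close> is of order \<open>\<eta>\<close> there. The cutoff is then \<open>1 - exp (- N E)\<close> with large \<open>N\<close>.\<close>

lemma entire_cutoff:
  assumes "compact X" "entire l" and "\<rho> > 0" "0 < \<kappa>" "\<kappa> \<le> 1" "\<epsilon> > 0"
    and geo: "\<And>p. p \<in> X \<Longrightarrow> l p \<in> \<real> \<or> cmod (l p) \<le> \<rho> \<or> \<kappa> * \<bar>Re (l p)\<bar> \<le> \<bar>Im (l p)\<bar>"
  obtains \<Theta> where "entire \<Theta>"
    "\<And>p. \<lbrakk>p \<in> X; l p \<in> \<real>\<rbrakk> \<Longrightarrow> cmod (\<Theta> p) \<le> 3"
    "\<And>p. \<lbrakk>p \<in> X; l p \<in> \<real>; 2 * \<rho> \<le> cmod (l p)\<rbrakk> \<Longrightarrow> cmod (\<Theta> p - 1) \<le> \<epsilon>"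
    "\<And>p. \<lbrakk>p \<in> X; cmod (l p) \<le> \<rho> \<or> \<kappa> * \<bar>Re (l p)\<bar> \<le> \<bar>Im (l p)\<bar>\<rbrakk> \<Longrightarrow> cmod (\<Theta> p) \<le> \<epsilon>"
proof -
  obtain R where R: "R > 0" "\<And>p. p \<in> X \<Longrightarrow> cmod (l p) \<le> R"
    using compact_imp_bounded[OF compact_continuous_image[OF 
      entire_imp_continuous_on[OF \<open>entire l\<close>] \<open>compact X\<close>]]
    by (auto simp: bounded_pos)
  define N where "N = 4 * (\<bar>ln \<epsilon>\<bar> + 1)"
  \<comment> \<open>\<open>\<tau>\<close> bounds both the size of \<open>E\<close> where the cutoff must be small and the error of its entire
    approximation \<open>E'\<close>; it has to stay small after multiplication by \<open>N\<close>.\<close>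
  define \<tau> where "\<tau> = min (1/4) (min (1 / (4 * N)) (\<epsilon> / (4 * N)))"
  define d where "d = \<kappa> * \<rho> / 2"
  \<comment> \<open>The bound \<open>d/2\<close> keeps the rays of the poles outside the sector; the last bound makes the sum of the
    bumps at most \<open>\<tau>\<close> on the disc and the sector, where \<open>R\<close> bounds \<open>l\<close> and thereby the number of bumps.\<close>
  define \<eta> where "\<eta> = min 1 (min (d/2) (\<tau> * d\<^sup>2 / (4 * (R + 2))))"
  define K where "K = nat \<lceil>R / \<eta>\<rceil>"
  have "N > 0" unfolding N_def by (intro mult_pos_pos add_nonneg_pos) auto
  then have "\<tau> > 0" using \<open>\<epsilon> > 0\<close> by (simp add: \<tau>_def)
  moreover have "d > 0" using assms by (simp add: d_def)
  ultimately have pos: "N > 0" "\<tau> > 0" "d > 0" "\<eta> > 0"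
    using \<open>N > 0\<close> \<open>R > 0\<close> by (simp_all add: \<eta>_def)
  have \<eta>: "\<eta> \<le> 1" "\<eta> \<le> d/2" "\<eta> \<le> \<tau> * d\<^sup>2 / (4 * (R + 2))"
    unfolding \<eta>_def
    by (rule min.cobounded1 min.coboundedI2[OF min.cobounded1] min.coboundedI2[OF min.cobounded2])+
  have \<kappa>\<rho>: "\<kappa> * \<rho> \<le> \<rho>" using assms by simp
  define T where "T s p = 1 / (1 + ((l p - complex_of_real s) / complex_of_real \<eta>)\<^sup>2)" for s p
  define I where "I = {..K} \<times> {1, -1::real}"
  define s where "s i = snd i * (2 * \<rho> + real (fst i) * \<eta>)" for i
  define E where "E p = (\<Sum>i\<in>I. T (s i) p)" for p
  have s: "2 * \<rho> \<le> \<bar>s i\<bar>" if "i \<in> I" for i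
    using that \<open>\<rho> > 0\<close> \<open>\<eta> > 0\<close> by (auto simp: I_def s_def abs_mult)
  have "entire_approximable X (T (s i))" if "i \<in> I" for i
    unfolding T_def
  proof (rule entire_approximable_cauchy_bump[OF \<open>compact X\<close> \<open>entire l\<close> _ \<open>\<eta> > 0\<close> \<open>0 < \<kappa>\<close>])
    have "\<eta> < \<kappa> * (2 * \<rho>)" 
      using \<eta>(2) pos mult_pos_pos[OF \<open>0 < \<kappa>\<close> \<open>\<rho> > 0\<close>] by (simp add: d_def)
    also have "\<dots> \<le> \<kappa> * \<bar>s i\<bar>" using s[OF that] \<open>0 < \<kappa>\<close> by (intro mult_left_mono) auto
    finally show "\<eta> < \<kappa> * \<bar>s i\<bar>" .
  qed (use s[OF that] \<open>\<rho> > 0\<close> geo in force)+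
  then have "entire_approximable X E"
    unfolding E_def by (rule entire_approximable_sum)
  then obtain E' where E': "entire E'" "\<And>p. p \<in> X \<Longrightarrow> cmod (E p - E' p) < \<tau>"
    using entire_approximableD \<open>\<tau> > 0\<close> by blast
  have T_real: "T u p = complex_of_real (1 / (1 + ((Re (l p) - u) / \<eta>)\<^sup>2))" if "l p \<in> \<real>" for u p
    using that by (auto simp: T_def elim!: Reals_cases)
  have T_pos: "T u p \<in> \<real>" "0 \<le> Re (T u p)" if "l p \<in> \<real>" for u p
    using T_real[OF that, of u] by simp_all
  have E_real: "E p \<in> \<real>" "0 \<le> Re (E p)" if "l p \<in> \<real>" for p
    unfolding E_def Re_sum using T_pos[OF that] by (blast intro: sum_nonneg sum_in_Reals)+
  have E_big: "1/2 \<le> Re (E p)" if "p \<in> X" "l p \<in> \<real>" "2 * \<rho> \<le> cmod (l p)" for p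
  proof -
    define x where "x = Re (l p)"
    have x: "cmod (l p) = \<bar>x\<bar>" using that(2) by (simp add: x_def in_Reals_norm)
    define k where "k = nat \<lfloor>(\<bar>x\<bar> - 2 * \<rho>) / \<eta>\<rfloor>"
    define i where "i = (k, if x \<ge> 0 then 1 else -1 :: real)"
    have nn: "0 \<le> (\<bar>x\<bar> - 2 * \<rho>) / \<eta>" using that(3) pos x by simp
    have kl: "real k \<le> (\<bar>x\<bar> - 2 * \<rho>) / \<eta>" "(\<bar>x\<bar> - 2 * \<rho>) / \<eta> < real k + 1"
      unfolding k_def using nn by linarith+
    have "(\<bar>x\<bar> - 2 * \<rho>) / \<eta> \<le> R / \<eta>"
      using R(2)[OF that(1)] x pos \<open>\<rho> > 0\<close> by (intro divide_right_mono) auto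
    then have "k \<le> K" unfolding k_def K_def by (intro nat_mono) linarith
    then have iI: "i \<in> I" by (auto simp: i_def I_def)
    have "\<bar>x - s i\<bar> \<le> \<eta>"
    proof -
      have "real k * \<eta> \<le> \<bar>x\<bar> - 2 * \<rho>" "\<bar>x\<bar> - 2 * \<rho> < (real k + 1) * \<eta>"
        using kl pos by (simp_all add: field_simps)
      then show ?thesis by (auto simp: s_def i_def algebra_simps)
    qed
    then have "\<bar>(x - s i) / \<eta>\<bar> \<le> 1" using pos by simp
    then have "((x - s i) / \<eta>)\<^sup>2 \<le> 1" by (simp only: abs_square_le_1)
    then have "1/2 \<le> 1 / (1 + ((x - s i) / \<eta>)\<^sup>2)"
      by (intro divide_left_mono mult_pos_pos add_pos_nonneg) auto
    also have "\<dots> = Re (T (s i) p)" unfolding T_real[OF that(2)] x_def by simp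
    also have "\<dots> \<le> (\<Sum>i\<in>I. Re (T (s i) p))"
      by (rule member_le_sum[OF iI]) (use T_pos(2)[OF that(2)] in \<open>auto simp: I_def\<close>)
    also have "\<dots> = Re (E p)" by (simp add: E_def)
    finally show ?thesis .
  qed
  have E_small: "cmod (E p) \<le> \<tau>"
    if "p \<in> X" "cmod (l p) \<le> \<rho> \<or> \<kappa> * \<bar>Re (l p)\<bar> \<le> \<bar>Im (l p)\<bar>" for p
  proof -
    have far: "d \<le> cmod (l p - complex_of_real (s i))" if "i \<in> I" for i
      using \<open>cmod (l p) \<le> \<rho> \<or> \<kappa> * \<bar>Re (l p)\<bar> \<le> \<bar>Im (l p)\<bar>\<close>
    proof
      assume "cmod (l p) \<le> \<rho>"
      then have "\<rho> \<le> cmod (l p - complex_of_real (s i))"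
        using s[OF that] norm_triangle_ineq3[of "l p" "complex_of_real (s i)"] by simp
      then show ?thesis using \<kappa>\<rho> \<open>\<rho> > 0\<close> unfolding d_def by linarith
    next
      assume w: "\<kappa> * \<bar>Re (l p)\<bar> \<le> \<bar>Im (l p)\<bar>"
      show ?thesis
      proof (rule ccontr)
        assume "\<not> d \<le> cmod (l p - complex_of_real (s i))"
        then have "\<bar>Re (l p) - s i\<bar> < d" "\<bar>Im (l p)\<bar> < d"
          using abs_Re_le_cmod[of "l p - complex_of_real (s i)"]
            abs_Im_le_cmod[of "l p - complex_of_real (s i)"] by auto
        then have "\<rho> \<le> \<bar>Re (l p)\<bar>" using s[OF that] \<kappa>\<rho> \<open>\<rho> > 0\<close> unfolding d_def by linarith
        then have "\<kappa> * \<rho> \<le> \<kappa> * \<bar>Re (l p)\<bar>" using \<open>0 < \<kappa>\<close> by simp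
        then show False using w \<open>\<bar>Im (l p)\<bar> < d\<close> pos by (simp add: d_def)
      qed
    qed
    have "cmod (T (s i) p) \<le> 2 * \<eta>\<^sup>2 / d\<^sup>2" if "i \<in> I" for i
    proof -
      define u where "u = ((l p - complex_of_real (s i)) / complex_of_real \<eta>)\<^sup>2"
      have "(d / \<eta>)\<^sup>2 \<le> (cmod (l p - complex_of_real (s i)) / \<eta>)\<^sup>2"
        using far[OF that] pos by (intro power_mono divide_right_mono) auto
      also have "\<dots> = cmod u" using pos by (simp add: u_def norm_divide norm_power)
      finally have 1: "(d / \<eta>)\<^sup>2 \<le> cmod u" .
      have "2\<^sup>2 \<le> (d / \<eta>)\<^sup>2" using \<eta>(2) pos by (intro power_mono) (auto simp: field_simps)
      with 1 have "(d / \<eta>)\<^sup>2 / 2 \<le> cmod u - 1" by simp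
      also have "\<dots> \<le> cmod (1 + u)" using norm_triangle_ineq2[of u "-1"] by (simp add: add.commute)
      finally have "1 / cmod (1 + u) \<le> 1 / ((d / \<eta>)\<^sup>2 / 2)"
        using pos by (intro divide_left_mono mult_pos_pos) (auto intro: less_le_trans)
      then show ?thesis using pos
        unfolding T_def u_def[symmetric] by (simp add: norm_divide power_divide mult.commute)
    qed
    then have "cmod (E p) \<le> real (card I) * (2 * \<eta>\<^sup>2 / d\<^sup>2)"
      unfolding E_def by (intro order_trans[OF norm_sum] sum_bounded_above)
    also have "real (card I) = 2 * (real K + 1)"
      by (simp add: I_def card_cartesian_product)
    also have "2 * (real K + 1) * (2 * \<eta>\<^sup>2 / d\<^sup>2) \<le> 2 * (R / \<eta> + 2) * (2 * \<eta>\<^sup>2 / d\<^sup>2)"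
    proof -
      have "real K \<le> R / \<eta> + 1"
        unfolding K_def using pos \<open>R > 0\<close> divide_nonneg_pos[of R \<eta>] by linarith
      then show ?thesis by (intro mult_right_mono) auto
    qed
    also have "\<dots> = 4 * (R + 2 * \<eta>) * \<eta> / d\<^sup>2"
      using pos by (simp add: field_simps power2_eq_square)
    also have "\<dots> \<le> 4 * (R + 2) * \<eta> / d\<^sup>2"
      using pos \<eta>(1) \<open>R > 0\<close> by (intro divide_right_mono mult_right_mono) auto
    also have "\<dots> \<le> \<tau>"
      using \<eta>(3) pos \<open>R > 0\<close> by (simp add: field_simps)
    finally show ?thesis .
  qed
  define \<Theta> where "\<Theta> p = 1 - exp (complex_of_real (- N) * E' p)" for p
  have normexp: "cmod (exp (complex_of_real (- N) * E' p)) = exp (- N * Re (E' p))" for p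
    by simp
  have Re_close: "Re (E p) - \<tau> \<le> Re (E' p)" if "p \<in> X" for p
    using E'(2)[OF that] abs_Re_le_cmod[of "E p - E' p"] by simp
  have \<tau>: "\<tau> \<le> 1/4" "N * \<tau> \<le> 1/4" "4 * (N * \<tau>) \<le> \<epsilon>"
  proof -
    show "\<tau> \<le> 1/4" by (simp add: \<tau>_def)
    have "\<tau> \<le> 1 / (4 * N)" "\<tau> \<le> \<epsilon> / (4 * N)" unfolding \<tau>_def by linarith+
    then show "N * \<tau> \<le> 1/4" "4 * (N * \<tau>) \<le> \<epsilon>" using pos by (simp_all add: field_simps)
  qed
  show thesis
  proof
    show "entire \<Theta>"
      unfolding \<Theta>_def by (intro entire_diff entire_exp entire_mult entire_const E')
  next
    fix p assume p: "p \<in> X" "l p \<in> \<real>"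
    have "- \<tau> \<le> Re (E' p)" using Re_close[OF p(1)] E_real(2)[OF p(2)] by simp
    then have "N * - \<tau> \<le> N * Re (E' p)" using pos by (intro mult_left_mono) auto
    then have "- N * Re (E' p) \<le> 1/4" using \<tau>(2) by simp
    then have "exp (- N * Re (E' p)) \<le> exp (1/4)" by simp
    also have "exp (1/4) \<le> (2::real)"
      using exp_bound[of "1/4"] by (simp add: power2_eq_square)
    finally show "cmod (\<Theta> p) \<le> 3"
      unfolding \<Theta>_def using norm_triangle_ineq4[of 1 "exp (complex_of_real (- N) * E' p)"] normexp[of p]
      by simp
  next
    fix p assume p: "p \<in> X" "l p \<in> \<real>" "2 * \<rho> \<le> cmod (l p)"
    have "1/4 \<le> Re (E' p)" using Re_close[OF p(1)] E_big[OF p] \<tau>(1) by simp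
    then have "N * (1/4) \<le> N * Re (E' p)" using pos by (intro mult_left_mono) auto
    moreover have "- (N * (1/4)) \<le> ln \<epsilon>" 
      using abs_ge_minus_self[of "ln \<epsilon>"] by (simp add: N_def field_simps)
    ultimately have "- N * Re (E' p) \<le> ln \<epsilon>" by linarith
    then have "exp (- N * Re (E' p)) \<le> exp (ln \<epsilon>)" by (simp only: exp_le_cancel_iff)
    then show "cmod (\<Theta> p - 1) \<le> \<epsilon>"
      unfolding \<Theta>_def using normexp[of p] \<open>\<epsilon> > 0\<close> by simp
  next
    fix p assume p: "p \<in> X" "cmod (l p) \<le> \<rho> \<or> \<kappa> * \<bar>Re (l p)\<bar> \<le> \<bar>Im (l p)\<bar>"
    have "cmod (E' p) \<le> 2 * \<tau>"
      using norm_triangle_ineq4[of "E p" "E p - E' p"] E_small[OF p] E'(2)[OF p(1)] by simp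
    then have "N * cmod (E' p) \<le> N * (2 * \<tau>)" using pos by (intro mult_left_mono) auto
    then have small: "cmod (complex_of_real (- N) * E' p) \<le> 2 * (N * \<tau>)"
      using pos by (simp add: norm_mult)
    define u where "u = complex_of_real (- N) * E' p"
    have u: "cmod u \<le> 1/2" using small \<tau>(2) unfolding u_def by linarith
    have "exp \<bar>Re u\<bar> \<le> exp (1/2)" using u abs_Re_le_cmod[of u] by simp
    also have "exp (1/2) \<le> (2::real)" using exp_bound[of "1/2"] by (simp add: power2_eq_square)
    finally have "exp \<bar>Re u\<bar> * cmod u \<le> 2 * cmod u" by (intro mult_right_mono) auto
    then have "cmod (exp (complex_of_real (- N) * E' p) - 1) 
        \<le> 2 * cmod (complex_of_real (- N) * E' p)"
      using Taylor_exp[of u 0] unfolding u_def by simp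
    then have "cmod (exp (complex_of_real (- N) * E' p) - 1) \<le> \<epsilon>"
      using small \<tau>(2,3) mult_pos_pos[OF pos(1,2)] by linarith
    then show "cmod (\<Theta> p) \<le> \<epsilon>"
      unfolding \<Theta>_def by (simp add: norm_minus_commute)
  qed
qed

text \<open>The restrictions to \<open>Q\<close> of entire functions that are real there form an algebra of real functions,
  and the two coordinates \<open>s\<close> and \<open>t\<close> in it separate points.\<close>

lemma Stone_Weierstrass_entire:
  assumes "compact Q" "entire s" "entire t"
    and real: "\<And>p. p \<in> Q \<Longrightarrow> s p \<in> \<real> \<and> t p \<in> \<real>"
    and sep: "\<And>p q. \<lbrakk>p \<in> Q; q \<in> Q; s p = s q; t p = t q\<rbrakk> \<Longrightarrow> p = q"
    and "continuous_on Q h"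
  shows "entire_approximable Q h"
proof -
  define P where "P f \<longleftrightarrow> (\<exists>g. entire g \<and> (\<forall>p\<in>Q. g p = complex_of_real (f p)))"
    for f :: "complex^2 \<Rightarrow> real"
  have cont: "continuous_on Q f" if Pf: "P f" for f
  proof -
    obtain g where g: "entire g" "\<And>p. p \<in> Q \<Longrightarrow> g p = complex_of_real (f p)"
      using Pf unfolding P_def by blast
    have "continuous_on Q (\<lambda>p. Re (g p))"
      by (intro continuous_intros entire_imp_continuous_on g(1))
    then show ?thesis by (rule continuous_on_eq) (simp add: g(2))
  qed
  have const: "P (\<lambda>p. c)" for c
    unfolding P_def by (intro exI[of _ "\<lambda>p. complex_of_real c"]) simp
  have add: "P (\<lambda>p. f p + g p)" and mult: "P (\<lambda>p. f p * g p)" if fg: "P f \<and> P g" for f g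
  proof -
    obtain f' g' where f': "entire f'" "\<And>p. p \<in> Q \<Longrightarrow> f' p = complex_of_real (f p)"
      and g': "entire g'" "\<And>p. p \<in> Q \<Longrightarrow> g' p = complex_of_real (g p)"
      using fg unfolding P_def by blast
    show "P (\<lambda>p. f p + g p)"
      unfolding P_def using f'(2) g'(2) entire_add[OF f'(1) g'(1)]
      by (intro exI[of _ "\<lambda>p. f' p + g' p"]) simp
    show "P (\<lambda>p. f p * g p)"
      unfolding P_def using f'(2) g'(2) entire_mult[OF f'(1) g'(1)]
      by (intro exI[of _ "\<lambda>p. f' p * g' p"]) simp
  qed
  have Pst: "P (\<lambda>p. Re (s p))" "P (\<lambda>p. Re (t p))"
  proof -
    show "P (\<lambda>p. Re (s p))"
      unfolding P_def using real \<open>entire s\<close> by (intro exI[of _ s]) simp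
    show "P (\<lambda>p. Re (t p))"
      unfolding P_def using real \<open>entire t\<close> by (intro exI[of _ t]) simp
  qed
  have separates: "\<exists>f. P f \<and> f p \<noteq> f q" if "p \<in> Q \<and> q \<in> Q \<and> p \<noteq> q" for p q
  proof (rule ccontr)
    assume "\<nexists>f. P f \<and> f p \<noteq> f q"
    then have "Re (s p) = Re (s q)" "Re (t p) = Re (t q)" using Pst by auto
    then have "s p = s q" "t p = t q" using real[of p] real[of q] that
      by (simp_all add: complex_eq_iff complex_is_Real_iff)
    then show False using sep that by blast
  qed
  have real_case: "\<exists>G. entire G \<and> (\<forall>p\<in>Q. cmod (complex_of_real (u p) - G p) < e)"
    if u: "continuous_on Q u" "e > 0" for u e
  proof -
    have "\<exists>f. P f \<and> (\<forall>p\<in>Q. \<bar>u p - f p\<bar> < e)"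
      by (rule Stone_Weierstrass_HOL[of Q P, OF \<open>compact Q\<close>])
        (fact const cont add mult separates u)+
    then obtain f G where f: "\<And>p. p \<in> Q \<Longrightarrow> \<bar>u p - f p\<bar> < e"
      and G: "entire G" "\<And>p. p \<in> Q \<Longrightarrow> G p = complex_of_real (f p)"
      unfolding P_def by blast
    have "cmod (complex_of_real (u p) - G p) < e" if "p \<in> Q" for p
      using f[OF that] G(2)[OF that] by (metis norm_of_real of_real_diff)
    with G(1) show ?thesis by (intro exI[of _ G]) simp
  qed
  have "entire_approximable Q (\<lambda>p. complex_of_real (Re (h p)))"
    "entire_approximable Q (\<lambda>p. complex_of_real (Im (h p)))"
    unfolding entire_approximable_def
    by (intro allI impI real_case continuous_on_Re continuous_on_Im \<open>continuous_on Q h\<close>; assumption)+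
  note reim = this
  have bdd: "\<exists>B. \<forall>p\<in>Q. cmod (complex_of_real (Im (h p))) \<le> B"
    using compact_imp_bounded[OF compact_continuous_image[OF continuous_on_Im[OF \<open>continuous_on Q h\<close>] \<open>compact Q\<close>]]
    by (auto simp: bounded_iff)
  then obtain B where B: "\<And>p. p \<in> Q \<Longrightarrow> cmod (complex_of_real (Im (h p))) \<le> B" by blast
  have "entire_approximable Q (\<lambda>p. \<i> * complex_of_real (Im (h p)))"
    by (rule entire_approximable_mult[OF entire_imp_approximable[OF entire_const] _ reim(2) B, where B = 1])
      simp_all
  from entire_approximable_add[OF reim(1) this] show ?thesis
    by (simp flip: complex_eq)
qed

text \<open>An entire function \<open>G\<close> that is close to \<open>h\<close> on \<open>Q\<close> is uncontrolled on the rest of \<open>X\<close>, so it is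
  multiplied by a cutoff whose precision is chosen afterwards, depending on the size of \<open>G\<close>. In the
  transition zone \<open>h\<close> vanishes and \<open>G\<close> is small, so boundedness of the cutoff is enough there.\<close>

lemma localized_approximation:
  assumes "compact X" "compact Q" "Q \<subseteq> X" "entire l" "entire s" "entire t"
    and real: "\<And>p. p \<in> Q \<Longrightarrow> l p \<in> \<real> \<and> s p \<in> \<real> \<and> t p \<in> \<real>"
    and sep: "\<And>p q. \<lbrakk>p \<in> Q; q \<in> Q; s p = s q; t p = t q\<rbrakk> \<Longrightarrow> p = q"
    and "\<rho> > 0" "0 < \<kappa>" "\<kappa> \<le> 1"
    and geo: "\<And>p. \<lbrakk>p \<in> X; p \<notin> Q\<rbrakk> \<Longrightarrow> cmod (l p) \<le> \<rho> \<or> \<kappa> * \<bar>Re (l p)\<bar> \<le> \<bar>Im (l p)\<bar>"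
    and h: "continuous_on Q h" "\<And>p. \<lbrakk>p \<in> Q; cmod (l p) \<le> 2 * \<rho>\<rbrakk> \<Longrightarrow> h p = 0"
  shows "entire_approximable X (\<lambda>p. if p \<in> Q then h p else 0)"
  unfolding entire_approximable_def
proof (intro allI impI)
  fix \<delta> :: real assume "\<delta> > 0"
  have "entire_approximable Q h"
    by (rule Stone_Weierstrass_entire[OF \<open>compact Q\<close> \<open>entire s\<close> \<open>entire t\<close> _ sep h(1)])
      (use real in blast)+
  moreover have "\<delta>/8 > 0" using \<open>\<delta> > 0\<close> by simp
  ultimately obtain G where G: "entire G" "\<And>p. p \<in> Q \<Longrightarrow> cmod (h p - G p) < \<delta>/8"
    unfolding entire_approximable_def by blast
  obtain B where B: "B > 0" "\<And>p. p \<in> X \<Longrightarrow> cmod (G p) \<le> B"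
    using compact_imp_bounded[OF compact_continuous_image[OF 
      entire_imp_continuous_on[OF \<open>entire G\<close>] \<open>compact X\<close>]]
    by (auto simp: bounded_pos)
  define \<epsilon> where "\<epsilon> = \<delta> / (4 * B)"
  have "\<epsilon> > 0" using \<open>\<delta> > 0\<close> \<open>B > 0\<close> by (simp add: \<epsilon>_def)
  have \<epsilon>B: "a * cmod (G p) \<le> \<delta>/4" if "0 \<le> a" "a \<le> \<epsilon>" "p \<in> X" for a p
  proof -
    have "a * cmod (G p) \<le> \<epsilon> * B" using that B by (intro mult_mono) auto
    then show ?thesis using B(1) by (simp add: \<epsilon>_def)
  qed
  have "l p \<in> \<real> \<or> cmod (l p) \<le> \<rho> \<or> \<kappa> * \<bar>Re (l p)\<bar> \<le> \<bar>Im (l p)\<bar>" if "p \<in> X" for p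
    using geo real that by blast
  from entire_cutoff[OF \<open>compact X\<close> \<open>entire l\<close> \<open>\<rho> > 0\<close> \<open>0 < \<kappa>\<close> \<open>\<kappa> \<le> 1\<close> \<open>\<epsilon> > 0\<close> this]
  obtain \<Theta> where \<Theta>: "entire \<Theta>"
    "\<And>p. \<lbrakk>p \<in> X; l p \<in> \<real>\<rbrakk> \<Longrightarrow> cmod (\<Theta> p) \<le> 3"
    "\<And>p. \<lbrakk>p \<in> X; l p \<in> \<real>; 2 * \<rho> \<le> cmod (l p)\<rbrakk> \<Longrightarrow> cmod (\<Theta> p - 1) \<le> \<epsilon>"
    "\<And>p. \<lbrakk>p \<in> X; cmod (l p) \<le> \<rho> \<or> \<kappa> * \<bar>Re (l p)\<bar> \<le> \<bar>Im (l p)\<bar>\<rbrakk> \<Longrightarrow> cmod (\<Theta> p) \<le> \<epsilon>"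
    by blast
  have "cmod ((if p \<in> Q then h p else 0) - \<Theta> p * G p) < \<delta>" if p: "p \<in> X" for p
  proof -
    consider "p \<notin> Q" | "p \<in> Q" "cmod (l p) \<le> 2 * \<rho>" | "p \<in> Q" "2 * \<rho> \<le> cmod (l p)" by linarith
    then show ?thesis
    proof cases
      case 1
      have "cmod (\<Theta> p) * cmod (G p) \<le> \<delta>/4"
        by (intro \<epsilon>B \<Theta>(4) geo p 1) auto
      then show ?thesis using 1 \<open>\<delta> > 0\<close> by (simp add: norm_mult)
    next
      case 2
      have "cmod (\<Theta> p) * cmod (G p) \<le> 3 * (\<delta>/8)"
        using \<Theta>(2)[OF p] real[OF 2(1)] G(2)[OF 2(1)] h(2)[OF 2] by (intro mult_mono) auto
      then show ?thesis using 2 h(2)[OF 2] \<open>\<delta> > 0\<close> by (simp add: norm_mult)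
    next
      case 3
      have "cmod (\<Theta> p - 1) * cmod (G p) \<le> \<delta>/4"
        by (intro \<epsilon>B \<Theta>(3) p 3) (use real 3 in auto)
      moreover have "h p - \<Theta> p * G p = (h p - G p) - (\<Theta> p - 1) * G p" by (simp add: algebra_simps)
      then have "cmod (h p - \<Theta> p * G p) \<le> cmod (h p - G p) + cmod (\<Theta> p - 1) * cmod (G p)"
        by (metis norm_mult norm_triangle_ineq4)
      ultimately show ?thesis using G(2)[OF 3(1)] 3 \<open>\<delta> > 0\<close> by simp
    qed
  qed
  then show "\<exists>g. entire g \<and> (\<forall>p\<in>X. cmod ((if p \<in> Q then h p else 0) - g p) < \<delta>)"
    using entire_mult[OF \<Theta>(1) G(1)] by (intro exI[of _ "\<lambda>p. \<Theta> p * G p"]) simp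
qed

section \<open>Real planes in triangular position\<close>

text \<open>A strip of half-width \<open>b\<close> around the line \<open>c \<real>\<close> lies in a sector that avoids the real line, except
  for a disc with radius proportional to \<open>b\<close>. The estimate becomes weaker as \<open>\<kappa>\<close> decreases, which
  allows a common \<open>\<kappa>\<close> for finitely many lines.\<close>

lemma nonreal_multiple_wedge:
  assumes "c \<notin> \<real>"
  obtains \<kappa> where "\<kappa> > 0" "\<And>s v b. cmod v \<le> b \<Longrightarrow>
    cmod (c * complex_of_real s + v) \<le> b / \<kappa> \<or>
    \<kappa> * \<bar>Re (c * complex_of_real s + v)\<bar> \<le> \<bar>Im (c * complex_of_real s + v)\<bar>"
proof
  define y where "y = \<bar>Im c\<bar>"
  have y: "y > 0" "y \<le> cmod c"
    using assms abs_Im_le_cmod[of c] by (auto simp: y_def complex_is_Real_iff)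
  then have c: "cmod c > 0" by linarith
  define \<kappa> where "\<kappa> = y / (4 * cmod c)"
  show "\<kappa> > 0" using y c by (simp add: \<kappa>_def)
  fix s :: real and v b assume v: "cmod v \<le> b"
  define z where "z = c * complex_of_real s + v"
  have b: "0 \<le> b" using v norm_ge_zero order_trans by blast
  have Re: "\<bar>Re z\<bar> \<le> cmod c * \<bar>s\<bar> + b"
  proof -
    have "\<bar>Re z\<bar> \<le> cmod z" by (rule abs_Re_le_cmod)
    also have "\<dots> \<le> cmod c * \<bar>s\<bar> + cmod v"
      unfolding z_def by (metis norm_mult norm_of_real norm_triangle_ineq real_norm_def)
    finally show ?thesis using v by simp
  qed
  have Im: "y * \<bar>s\<bar> - b \<le> \<bar>Im z\<bar>"
  proof -
    have "\<bar>Im z\<bar> = \<bar>Im c * s + Im v\<bar>" by (simp add: z_def)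
    moreover have "\<bar>Im c * s\<bar> = y * \<bar>s\<bar>" by (simp add: y_def abs_mult)
    ultimately show ?thesis using abs_Im_le_cmod[of v] v by linarith
  qed
  show "cmod (c * complex_of_real s + v) \<le> b / \<kappa> \<or>
    \<kappa> * \<bar>Re (c * complex_of_real s + v)\<bar> \<le> \<bar>Im (c * complex_of_real s + v)\<bar>"
  proof (cases "2 * b \<le> y * \<bar>s\<bar>")
    case True
    have "y * \<bar>s\<bar> \<le> cmod c * \<bar>s\<bar>" using y by (intro mult_right_mono) auto
    then have "\<kappa> * \<bar>Re z\<bar> \<le> \<kappa> * (2 * (cmod c * \<bar>s\<bar>))"
      using Re True b \<open>\<kappa> > 0\<close> by (intro mult_left_mono) auto
    also have "\<dots> = y * \<bar>s\<bar> / 2" using c by (simp add: \<kappa>_def)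
    also have "\<dots> \<le> \<bar>Im z\<bar>" using Im True by simp
    finally show ?thesis by (simp add: z_def)
  next
    case False
    have "cmod z \<le> cmod c * \<bar>s\<bar> + b"
      unfolding z_def using v norm_triangle_ineq[of "c * complex_of_real s" v]
      by (simp add: norm_mult)
    also have "\<dots> \<le> cmod c * (2 * b / y) + b * (cmod c / y)"
    proof (intro add_mono mult_left_mono)
      show "\<bar>s\<bar> \<le> 2 * b / y" using False y by (simp add: field_simps)
      have "b * 1 \<le> b * (cmod c / y)" using b y by (intro mult_left_mono) auto
      then show "b \<le> b * (cmod c / y)" by simp
    qed auto
    also have "\<dots> \<le> b / \<kappa>" using b y c by (simp add: \<kappa>_def field_simps)
    finally show ?thesis by (simp add: z_def)
  qed
qed

lemma finite_nonreal_wedge: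
  assumes "finite K" "\<And>k. k \<in> K \<Longrightarrow> c k \<notin> \<real>"
  obtains \<kappa> where "0 < \<kappa>" "\<kappa> \<le> 1" "\<And>k s v b. \<lbrakk>k \<in> K; cmod v \<le> b\<rbrakk> \<Longrightarrow>
    cmod (c k * complex_of_real s + v) \<le> b / \<kappa> \<or>
    \<kappa> * \<bar>Re (c k * complex_of_real s + v)\<bar> \<le> \<bar>Im (c k * complex_of_real s + v)\<bar>"
proof -
  define P where "P k \<kappa> \<longleftrightarrow> (\<forall>s v b. cmod v \<le> b \<longrightarrow> cmod (c k * complex_of_real s + v) \<le> b / \<kappa> \<or>
    \<kappa> * \<bar>Re (c k * complex_of_real s + v)\<bar> \<le> \<bar>Im (c k * complex_of_real s + v)\<bar>)" for k \<kappa>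
  have "eventually (P k) (at_right 0)" if kK: "k \<in> K" for k
  proof -
    obtain \<kappa> where \<kappa>: "\<kappa> > 0" "P k \<kappa>"
      unfolding P_def by (rule nonreal_multiple_wedge[OF assms(2)[OF kK]]) blast
    have "P k \<kappa>'" if "0 < \<kappa>'" "\<kappa>' < \<kappa>" for \<kappa>'
      unfolding P_def
    proof (intro allI impI)
      fix s :: real and v b assume v: "cmod v \<le> b"
      then have "0 \<le> b" using norm_ge_zero order_trans by blast
      define z where "z = c k * complex_of_real s + v"
      have "b / \<kappa> \<le> b / \<kappa>'" using that \<open>0 \<le> b\<close> by (intro divide_left_mono) auto
      moreover have "\<kappa>' * \<bar>Re z\<bar> \<le> \<kappa> * \<bar>Re z\<bar>" using that by (intro mult_right_mono) auto
      moreover have "cmod z \<le> b / \<kappa> \<or> \<kappa> * \<bar>Re z\<bar> \<le> \<bar>Im z\<bar>"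
        using \<kappa>(2) v unfolding P_def z_def by blast
      ultimately show "cmod (c k * complex_of_real s + v) \<le> b / \<kappa>' \<or>
        \<kappa>' * \<bar>Re (c k * complex_of_real s + v)\<bar> \<le> \<bar>Im (c k * complex_of_real s + v)\<bar>"
        unfolding z_def by linarith
    qed
    then show ?thesis using eventually_at_right_less[of 0] \<kappa>(1)
      by (auto simp: eventually_at_right_field)
  qed
  then have "\<forall>\<^sub>F \<kappa> in at_right 0. \<forall>k\<in>K. P k \<kappa>"
    using \<open>finite K\<close> by (simp add: eventually_ball_finite)
  moreover have "\<forall>\<^sub>F \<kappa>::real in at_right 0. \<kappa> \<in> {0<..<1}"
    by (rule eventually_at_right_real) simp
  ultimately have "\<forall>\<^sub>F \<kappa> in at_right 0. (\<forall>k\<in>K. P k \<kappa>) \<and> \<kappa> \<in> {0<..<1}"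
    by (rule eventually_conj)
  then have "\<exists>\<kappa>. (\<forall>k\<in>K. P k \<kappa>) \<and> \<kappa> \<in> {0<..<1}"
    by (rule eventually_happens'[OF trivial_limit_at_right_real])
  then obtain \<kappa> where \<kappa>: "\<And>k. k \<in> K \<Longrightarrow> P k \<kappa>" "0 < \<kappa>" "\<kappa> < 1" by auto
  show thesis
    by (rule that[OF \<kappa>(2) less_imp_le[OF \<kappa>(3)]]) (use \<kappa>(1) in \<open>simp add: P_def\<close>)
qed

definition tri_plane :: "complex \<Rightarrow> complex \<Rightarrow> complex \<Rightarrow> (complex^2) set" where
  "tri_plane a b d = {p. \<exists>s t. p $ 1 = a * complex_of_real s + b * complex_of_real t \<and>
     p $ 2 = d * complex_of_real t}"

text \<open>Finitely many planes with distinct lines \<open>\<alpha>\<^sub>j \<real>\<close> and distinct lines \<open>\<delta>\<^sub>j \<real>\<close>; equivalently, in this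
  triangular form, totally real planes that meet pairwise only in 0.\<close>

locale triangular_planes =
  fixes J :: "'i set" and \<alpha> \<beta> \<delta> :: "'i \<Rightarrow> complex"
  assumes finite: "finite J"
    and nonzero: "\<And>j. j \<in> J \<Longrightarrow> \<alpha> j \<noteq> 0" "\<And>j. j \<in> J \<Longrightarrow> \<delta> j \<noteq> 0"
    and nonreal: "\<And>j k. \<lbrakk>j \<in> J; k \<in> J; j \<noteq> k\<rbrakk> \<Longrightarrow> \<alpha> k / \<alpha> j \<notin> \<real>"
      "\<And>j k. \<lbrakk>j \<in> J; k \<in> J; j \<noteq> k\<rbrakk> \<Longrightarrow> \<delta> k / \<delta> j \<notin> \<real>"
begin

abbreviation plane :: "'i \<Rightarrow> (complex^2) set" where
  "plane j \<equiv> tri_plane (\<alpha> j) (\<beta> j) (\<delta> j)"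

definition planes :: "(complex^2) set" where
  "planes = (\<Union>j\<in>J. plane j)"

text \<open>With \<open>scoord\<close> below these are the parameters \<open>t\<close> and \<open>s\<close> of the \<open>j\<close>-th plane, extended to complex linear
  coordinates on \<open>\<complex>\<^sup>2\<close>; the plane is the set where both are real.\<close>

definition tcoord :: "'i \<Rightarrow> complex^2 \<Rightarrow> complex" where
  "tcoord j p = p $ 2 / \<delta> j"

definition scoord :: "'i \<Rightarrow> complex^2 \<Rightarrow> complex" where
  "scoord j p = (p $ 1 - \<beta> j * tcoord j p) / \<alpha> j"

lemma entire_tcoord: "entire (tcoord j)"
  unfolding tcoord_def[abs_def]
  using entire_mult[OF entire_coord[of 2] entire_const[of "1 / \<delta> j"]] by simp

lemma entire_scoord: "entire (scoord j)"
proof -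
  have "entire (\<lambda>p. (p $ 1 - \<beta> j * tcoord j p) * (1 / \<alpha> j))"
    by (intro entire_mult entire_diff entire_coord entire_const entire_tcoord)
  then show ?thesis by (simp add: scoord_def[abs_def])
qed

lemma coords_eq:
  assumes "j \<in> J"
  shows "p $ 2 = \<delta> j * tcoord j p" "p $ 1 = \<alpha> j * scoord j p + \<beta> j * tcoord j p"
  using nonzero[OF assms] by (auto simp: tcoord_def scoord_def)

lemma coords_inj: "\<lbrakk>j \<in> J; scoord j p = scoord j q; tcoord j p = tcoord j q\<rbrakk> \<Longrightarrow> p = q"
  by (simp add: vec_eq_iff forall_2 coords_eq)

lemma mem_plane_iff:
  assumes "j \<in> J"
  shows "p \<in> plane j \<longleftrightarrow> scoord j p \<in> \<real> \<and> tcoord j p \<in> \<real>"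
proof
  assume "p \<in> plane j"
  then show "scoord j p \<in> \<real> \<and> tcoord j p \<in> \<real>"
    using nonzero[OF assms] by (auto simp: tri_plane_def tcoord_def scoord_def)
next
  assume "scoord j p \<in> \<real> \<and> tcoord j p \<in> \<real>"
  then obtain s t where "scoord j p = complex_of_real s" "tcoord j p = complex_of_real t"
    by (auto elim!: Reals_cases)
  then show "p \<in> plane j"
    unfolding tri_plane_def using coords_eq[OF assms, of p] by auto
qed

lemma closed_plane: "j \<in> J \<Longrightarrow> closed (plane j)"
proof -
  assume "j \<in> J"
  then have "plane j = scoord j -` \<real> \<inter> tcoord j -` \<real>" using mem_plane_iff by auto
  moreover have "closed (f -` \<real>)" if "entire f" for f :: "complex^2 \<Rightarrow> complex"
    using entire_imp_continuous_on[OF that] by (intro closed_vimage closed_complex_Reals)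
  ultimately show ?thesis using entire_scoord entire_tcoord by (metis closed_Int)
qed

lemma closed_planes: "closed planes"
  unfolding planes_def using closed_plane finite by (intro closed_UN) auto

text \<open>The coefficient of the \<open>k\<close>-th parameter \<open>t\<close> when the \<open>j\<close>-th coordinate \<open>s\<close> is expressed in the
  coordinates of the \<open>k\<close>-th plane. It is responsible for the width of the strips into which that
  coordinate maps the other planes.\<close>

definition shear :: "'i \<Rightarrow> 'i \<Rightarrow> complex" where
  "shear j k = (\<beta> k - \<beta> j * \<delta> k / \<delta> j) / \<alpha> j"

lemma coords_change:
  assumes "j \<in> J" "k \<in> J"
  shows "tcoord j p = \<delta> k / \<delta> j * tcoord k p"
    and "scoord j p = \<alpha> k / \<alpha> j * scoord k p + shear j k * tcoord k p"
  using nonzero[OF assms(1)] coords_eq[OF assms(2), of p]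
  by (auto simp: tcoord_def[of j] scoord_def[of j] shear_def field_simps)

lemma plane_Int:
  assumes "j \<in> J" "k \<in> J" "j \<noteq> k" "p \<in> plane j" "p \<in> plane k"
  shows "p = 0"
proof -
  have *: "z = 0" if "c * z \<in> \<real>" "z \<in> \<real>" "c \<notin> \<real>" for c z :: complex
    using that by (auto simp: complex_is_Real_iff complex_eq_iff)
  note r = assms(4,5)[unfolded mem_plane_iff[OF assms(1)] mem_plane_iff[OF assms(2)]]
  have t: "tcoord k p = 0"
    using *[of "\<delta> k / \<delta> j"] r nonreal assms coords_change(1)[of j k p] by metis
  then have "scoord k p = 0"
    using *[of "\<alpha> k / \<alpha> j" "scoord k p"] r nonreal assms coords_change(2)[of j k p] by simp
  with t show ?thesis
    using coords_inj[OF assms(2), of p 0] by (simp add: tcoord_def scoord_def)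
qed

lemma sum_over_planes:
  assumes "0 \<in> planes \<Longrightarrow> h 0 = 0"
  shows "(\<Sum>j\<in>J. if p \<in> plane j then h p else 0) = (if p \<in> planes then h p else (0::complex))"
proof (cases "h p = 0 \<or> p \<notin> planes")
  case True
  then show ?thesis by (auto simp: planes_def intro!: sum.neutral)
next
  case False
  then obtain j where j: "j \<in> J" "p \<in> plane j" by (auto simp: planes_def)
  have "p \<noteq> 0" using False assms by auto
  then have "(\<Sum>k\<in>J. if p \<in> plane k then h p else 0) = (\<Sum>k\<in>J. if k = j then h p else 0)"
    using plane_Int[OF j(1) _ _ j(2)] j by (intro sum.cong) auto
  then show ?thesis using False j finite by simp
qed

lemma tcoord_wedge:
  assumes "j \<in> J"
  obtains \<kappa> where "0 < \<kappa>" "\<kappa> \<le> 1" "\<And>k p. \<lbrakk>k \<in> J; k \<noteq> j; p \<in> plane k\<rbrakk> \<Longrightarrow> 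
    \<kappa> * \<bar>Re (tcoord j p)\<bar> \<le> \<bar>Im (tcoord j p)\<bar>"
proof -
  have "\<delta> k / \<delta> j \<notin> \<real>" if "k \<in> J - {j}" for k using nonreal(2) assms that by auto
  from finite_nonreal_wedge[of "J - {j}" "\<lambda>k. \<delta> k / \<delta> j", OF finite_Diff[OF finite] this]
  obtain \<kappa> where \<kappa>: "0 < \<kappa>" "\<kappa> \<le> 1" "\<And>k s v b. \<lbrakk>k \<in> J - {j}; cmod v \<le> b\<rbrakk> \<Longrightarrow>
    cmod (\<delta> k / \<delta> j * complex_of_real s + v) \<le> b / \<kappa> \<or>
    \<kappa> * \<bar>Re (\<delta> k / \<delta> j * complex_of_real s + v)\<bar> \<le> \<bar>Im (\<delta> k / \<delta> j * complex_of_real s + v)\<bar>"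
    by blast
  show thesis
  proof (rule that[OF \<kappa>(1,2)])
    fix k p assume k: "k \<in> J" "k \<noteq> j" "p \<in> plane k"
    then obtain t where t: "tcoord k p = complex_of_real t"
      using mem_plane_iff by (auto elim!: Reals_cases)
    have "cmod (tcoord j p) \<le> 0 / \<kappa> \<or> \<kappa> * \<bar>Re (tcoord j p)\<bar> \<le> \<bar>Im (tcoord j p)\<bar>"
      using \<kappa>(3)[of k 0 0 t] k coords_change(1)[OF assms k(1), of p] t by simp
    then show "\<kappa> * \<bar>Re (tcoord j p)\<bar> \<le> \<bar>Im (tcoord j p)\<bar>" by auto
  qed
qed

text \<open>The compact sets on which functions are approximated: a ball, on which the approximant has to be
  small, together with a larger bounded piece of the planes.\<close>

definition window :: "real \<Rightarrow> real \<Rightarrow> (complex^2) set" where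
  "window r R = cball 0 r \<union> (planes \<inter> cball 0 R)"

lemma compact_window: "compact (window r R)"
  unfolding window_def using closed_planes by (intro compact_Un compact_cball closed_Int_compact)

lemma plane_in_planes: "j \<in> J \<Longrightarrow> p \<in> plane j \<Longrightarrow> p \<in> planes"
  by (auto simp: planes_def)

lemma norm_le_coords: "norm p \<le> cmod (p $ 1) + cmod (p $ 2)" for p :: "complex^2"
  using L2_set_le_sum[of UNIV "\<lambda>i. cmod (p $ i)"] by (simp add: norm_vec_def sum_2)

lemma window_cases:
  assumes "p \<in> window r R"
  obtains "norm p \<le> r" | k where "k \<in> J" "p \<in> plane k"
  using assms by (auto simp: window_def planes_def)

lemma approximable_on_one_plane:
  assumes "j \<in> J" "r > 0"
    and X: "compact X" "X \<subseteq> window r R"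
    and l: "l = scoord j \<or> l = tcoord j" and \<rho>\<kappa>: "\<rho> > 0" "0 < \<kappa>" "\<kappa> \<le> 1"
    and geo: "\<And>p. norm p \<le> r \<Longrightarrow> cmod (l p) \<le> \<rho>"
      "\<And>k p. \<lbrakk>k \<in> J; k \<noteq> j; p \<in> plane k; p \<in> X\<rbrakk> \<Longrightarrow> cmod (l p) \<le> \<rho> \<or> \<kappa> * \<bar>Re (l p)\<bar> \<le> \<bar>Im (l p)\<bar>"
    and h: "continuous_on (plane j) h" "\<And>p. \<lbrakk>p \<in> plane j; p \<in> X; cmod (l p) \<le> 2 * \<rho>\<rbrakk> \<Longrightarrow> h p = 0"
  shows "entire_approximable X (\<lambda>p. if p \<in> plane j then h p else 0)"
proof -
  have "entire_approximable X (\<lambda>p. if p \<in> plane j \<inter> X then h p else 0)"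
  proof (rule localized_approximation[where l = l and s = "scoord j" and t = "tcoord j" 
        and \<rho> = \<rho> and \<kappa> = \<kappa>])
    show "compact (plane j \<inter> X)" using closed_plane[OF \<open>j \<in> J\<close>] \<open>compact X\<close> 
      by (rule closed_Int_compact)
    show "entire l" using l entire_scoord entire_tcoord by auto
    show "l p \<in> \<real> \<and> scoord j p \<in> \<real> \<and> tcoord j p \<in> \<real>" if "p \<in> plane j \<inter> X" for p
      using that l mem_plane_iff[OF \<open>j \<in> J\<close>, of p] by auto
    show "cmod (l p) \<le> \<rho> \<or> \<kappa> * \<bar>Re (l p)\<bar> \<le> \<bar>Im (l p)\<bar>" if "p \<in> X" "p \<notin> plane j \<inter> X" for p
    proof -
      have "p \<in> window r R" using X that by blast
      then show ?thesis
        by (rule window_cases) (use geo that in blast)+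
    qed
    show "continuous_on (plane j \<inter> X) h" using h(1) by (rule continuous_on_subset) auto
  qed (use assms entire_scoord entire_tcoord coords_inj[OF \<open>j \<in> J\<close>] in auto)
  then show ?thesis by (rule entire_approximable_cong) auto
qed

text \<open>Away from the axis \<open>p $ 2 = 0\<close> the coordinate \<open>tcoord j\<close> separates the \<open>j\<close>-th plane from all the others,
  because it maps them into distinct lines.\<close>

lemma approximable_away_from_axis:
  assumes "j \<in> J" "r > 0" and h: "continuous_on (plane j) h"
      "\<And>p. \<lbrakk>p \<in> plane j; cmod (p $ 2) \<le> 2 * r\<rbrakk> \<Longrightarrow> h p = 0"
  shows "entire_approximable (window r R) (\<lambda>p. if p \<in> plane j then h p else 0)"
proof -
  obtain \<kappa> where \<kappa>: "0 < \<kappa>" "\<kappa> \<le> 1" "\<And>k p. \<lbrakk>k \<in> J; k \<noteq> j; p \<in> plane k\<rbrakk> \<Longrightarrow> 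
    \<kappa> * \<bar>Re (tcoord j p)\<bar> \<le> \<bar>Im (tcoord j p)\<bar>"
    using tcoord_wedge[OF \<open>j \<in> J\<close>] by blast
  have d: "cmod (\<delta> j) > 0" using nonzero(2)[OF \<open>j \<in> J\<close>] by simp
  show ?thesis
  proof (rule approximable_on_one_plane[OF \<open>j \<in> J\<close> \<open>r > 0\<close> compact_window order_refl,
        where l = "tcoord j" and \<rho> = "r / cmod (\<delta> j)" and \<kappa> = \<kappa>])
    show "cmod (tcoord j p) \<le> r / cmod (\<delta> j)" if "norm p \<le> r" for p
      using that Finite_Cartesian_Product.norm_nth_le[of p 2] d by (auto simp: tcoord_def norm_divide intro!: divide_right_mono)
    show "h p = 0" if "p \<in> plane j" "cmod (tcoord j p) \<le> 2 * (r / cmod (\<delta> j))" for p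
      using that d by (intro h(2)) (auto simp: tcoord_def norm_divide field_simps)
  qed (use assms \<kappa> d in auto)
qed

text \<open>Near the axis \<open>p $ 2 = 0\<close> the coordinate \<open>scoord j\<close> does the separation. On the other planes it stays in
  strips of width proportional to \<open>r\<close>, so \<open>h\<close> has to vanish on a disc with radius a multiple of \<open>r\<close>.\<close>

lemma approximable_near_axis:
  assumes "j \<in> J"
  obtains C where "C > 0" "\<And>r R h. \<lbrakk>r > 0; continuous_on (plane j) h;
      \<And>p. \<lbrakk>p \<in> plane j; cmod (p $ 2) \<le> 6 * r; cmod (p $ 1) \<le> C * r\<rbrakk> \<Longrightarrow> h p = 0\<rbrakk> \<Longrightarrow>
    entire_approximable {p \<in> window r R. cmod (p $ 2) \<le> 6 * r} (\<lambda>p. if p \<in> plane j then h p else 0)"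
proof -
  have "\<alpha> k / \<alpha> j \<notin> \<real>" if "k \<in> J - {j}" for k using nonreal(1) assms that by auto
  from finite_nonreal_wedge[of "J - {j}" "\<lambda>k. \<alpha> k / \<alpha> j", OF finite_Diff[OF finite] this]
  obtain \<kappa> where \<kappa>: "0 < \<kappa>" "\<kappa> \<le> 1" "\<And>k s v b. \<lbrakk>k \<in> J - {j}; cmod v \<le> b\<rbrakk> \<Longrightarrow>
    cmod (\<alpha> k / \<alpha> j * complex_of_real s + v) \<le> b / \<kappa> \<or>
    \<kappa> * \<bar>Re (\<alpha> k / \<alpha> j * complex_of_real s + v)\<bar> \<le> \<bar>Im (\<alpha> k / \<alpha> j * complex_of_real s + v)\<bar>"
    by blast
  have ad: "cmod (\<alpha> j) > 0" "cmod (\<delta> j) > 0" using nonzero[OF \<open>j \<in> J\<close>] by auto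
  define w where "w k = cmod (shear j k) * (6 / cmod (\<delta> k)) / \<kappa>" for k
  have w: "w k \<ge> 0" for k using \<kappa>(1) by (simp add: w_def)
  \<comment> \<open>\<open>M r\<close> bounds \<open>scoord j\<close> on the ball of radius \<open>r\<close> (first summand) and the radius of the discs
    outside which the strips of the other planes lie in the sector that avoids the real line.\<close>
  define M where "M = (1 + cmod (\<beta> j) / cmod (\<delta> j)) / cmod (\<alpha> j) + (\<Sum>k\<in>J. w k)"
  have M: "M > 0" unfolding M_def using ad w
    by (intro add_pos_nonneg divide_pos_pos sum_nonneg) (auto intro!: add_pos_nonneg)
  have M1: "(1 + cmod (\<beta> j) / cmod (\<delta> j)) / cmod (\<alpha> j) \<le> M"
    unfolding M_def using w by (simp add: sum_nonneg)
  have M2: "w k \<le> M" if "k \<in> J" for k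
    unfolding M_def using w ad member_le_sum[OF that _ finite, of w] by (intro add_increasing) auto
  define C where "C = cmod (\<alpha> j) * (2 * M) + cmod (\<beta> j) * (6 / cmod (\<delta> j))"
  have "C > 0" unfolding C_def using M ad by (intro add_pos_nonneg) auto
  moreover have "entire_approximable {p \<in> window r R. cmod (p $ 2) \<le> 6 * r} (\<lambda>p. if p \<in> plane j then h p else 0)"
    if r: "r > 0" and h: "continuous_on (plane j) h"
      "\<And>p. \<lbrakk>p \<in> plane j; cmod (p $ 2) \<le> 6 * r; cmod (p $ 1) \<le> C * r\<rbrakk> \<Longrightarrow> h p = 0" for r R h
  proof (rule approximable_on_one_plane[OF \<open>j \<in> J\<close> \<open>r > 0\<close>,
        where l = "scoord j" and \<rho> = "M * r" and \<kappa> = \<kappa>])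
    have "{p \<in> window r R. cmod (p $ 2) \<le> 6 * r} = window r R \<inter> {p. cmod (p $ 2) \<le> 6 * r}" by auto
    moreover have "closed {p::complex^2. cmod (p $ 2) \<le> 6 * r}"
      by (intro closed_Collect_le continuous_intros)
    ultimately show "compact {p \<in> window r R. cmod (p $ 2) \<le> 6 * r}"
      using compact_Int_closed[OF compact_window] by simp
    show "cmod (scoord j p) \<le> M * r" if "norm p \<le> r" for p
    proof -
      have n: "cmod (p $ 1) \<le> r" "cmod (p $ 2) \<le> r"
        using that Finite_Cartesian_Product.norm_nth_le[of p] by (meson order_trans)+
      have "cmod (p $ 1 - \<beta> j * tcoord j p) \<le> cmod (p $ 1) + cmod (\<beta> j) * (cmod (p $ 2) / cmod (\<delta> j))"
        using norm_triangle_ineq4[of "p $ 1" "\<beta> j * tcoord j p"] by (simp add: tcoord_def norm_mult norm_divide)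
      also have "\<dots> \<le> r + cmod (\<beta> j) * (r / cmod (\<delta> j))"
        using n by (intro add_mono mult_left_mono divide_right_mono) auto
      finally have "cmod (scoord j p) \<le> (r + cmod (\<beta> j) * (r / cmod (\<delta> j))) / cmod (\<alpha> j)"
        unfolding scoord_def norm_divide by (rule divide_right_mono) simp
      also have "\<dots> = (1 + cmod (\<beta> j) / cmod (\<delta> j)) / cmod (\<alpha> j) * r" by (simp add: field_simps)
      also have "\<dots> \<le> M * r" using M1 r by (intro mult_right_mono) auto
      finally show ?thesis .
    qed
    show "cmod (scoord j p) \<le> M * r \<or> \<kappa> * \<bar>Re (scoord j p)\<bar> \<le> \<bar>Im (scoord j p)\<bar>"
      if k: "k \<in> J" "k \<noteq> j" and p: "p \<in> plane k" "p \<in> {p \<in> window r R. cmod (p $ 2) \<le> 6 * r}" for k p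
    proof -
      obtain s where s: "scoord k p = complex_of_real s"
        using p(1) mem_plane_iff[OF k(1)] by (auto elim!: Reals_cases)
      define v where "v = shear j k * tcoord k p"
      have "cmod (tcoord k p) \<le> 6 * r / cmod (\<delta> k)"
        unfolding tcoord_def norm_divide using p(2) by (intro divide_right_mono) auto
      then have "cmod v \<le> cmod (shear j k) * (6 * r / cmod (\<delta> k))"
        unfolding v_def norm_mult by (rule mult_left_mono) simp
      also have "\<dots> = w k * \<kappa> * r" using \<kappa>(1) by (simp add: w_def)
      also have "\<dots> \<le> M * \<kappa> * r" using M2[OF k(1)] \<kappa>(1) r by (intro mult_right_mono) auto
      finally have v: "cmod v \<le> M * \<kappa> * r" .
      have "scoord j p = \<alpha> k / \<alpha> j * complex_of_real s + v"
        using coords_change(2)[OF \<open>j \<in> J\<close> k(1), of p] s by (simp add: v_def)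
      moreover have "M * \<kappa> * r / \<kappa> = M * r" using \<kappa>(1) by simp
      ultimately show ?thesis using \<kappa>(3)[of k v "M * \<kappa> * r" s] k v by simp
    qed
    show "h p = 0" if p: "p \<in> plane j" "p \<in> {p \<in> window r R. cmod (p $ 2) \<le> 6 * r}"
      "cmod (scoord j p) \<le> 2 * (M * r)" for p
    proof (rule h(2)[OF p(1)])
      have t: "cmod (tcoord j p) \<le> 6 * r / cmod (\<delta> j)"
        unfolding tcoord_def norm_divide using p(2) by (intro divide_right_mono) auto
      have "cmod (p $ 1) \<le> cmod (\<alpha> j) * cmod (scoord j p) + cmod (\<beta> j) * cmod (tcoord j p)"
        using coords_eq(2)[OF \<open>j \<in> J\<close>, of p] norm_triangle_ineq[of "\<alpha> j * scoord j p" "\<beta> j * tcoord j p"]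
        by (simp add: norm_mult)
      also have "\<dots> \<le> cmod (\<alpha> j) * (2 * (M * r)) + cmod (\<beta> j) * (6 * r / cmod (\<delta> j))"
        using p(3) t by (intro add_mono mult_left_mono) auto
      also have "\<dots> = C * r" by (simp add: C_def algebra_simps)
      finally show "cmod (p $ 1) \<le> C * r" .
    qed (use p in auto)
  qed (use M \<kappa> r h in auto)
  ultimately show thesis by (rule that)
qed

text \<open>The approximants near the axis are uncontrolled where \<open>p $ 2\<close> is large. This cutoff removes them there: it
  is 1 minus the sum of the cutoffs in the coordinates \<open>tcoord j\<close>, and on the \<open>k\<close>-th plane, far from the
  axis, only the \<open>k\<close>-th of these is close to 1 and the others are close to 0.\<close>

lemma axis_cutoff:
  assumes r: "r > 0" and "\<epsilon> > 0"
  obtains \<phi> where "entire \<phi>"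
    "\<And>p. p \<in> window r R \<Longrightarrow> cmod (\<phi> p) \<le> 1 + 3 * real (card J)"
    "\<And>p. \<lbrakk>p \<in> window r R; cmod (p $ 2) \<le> 3 * r\<rbrakk> \<Longrightarrow> cmod (\<phi> p - 1) \<le> \<epsilon>"
    "\<And>p. \<lbrakk>p \<in> window r R; 6 * r \<le> cmod (p $ 2)\<rbrakk> \<Longrightarrow> cmod (\<phi> p) \<le> \<epsilon>"
proof -
  define e where "e = min 1 (\<epsilon> / (card J + 1))"
  have e: "e > 0" using \<open>\<epsilon> > 0\<close> by (simp add: e_def)
  have e1: "e \<le> 1" and ce: "card J * e \<le> \<epsilon>"
  proof -
    show "e \<le> 1" by (simp add: e_def)
    have "e \<le> \<epsilon> / (card J + 1)" unfolding e_def by simp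
    then have "(card J + 1) * e \<le> \<epsilon>" by (simp add: field_simps)
    then show "card J * e \<le> \<epsilon>" using e by (simp add: algebra_simps)
  qed
  have "\<exists>\<Theta>. entire \<Theta> \<and> (\<forall>p\<in>window r R. cmod (\<Theta> p) \<le> 3 \<and>
      (p \<in> plane j \<and> 6 * r \<le> cmod (p $ 2) \<longrightarrow> cmod (\<Theta> p - 1) \<le> e) \<and>
      (cmod (p $ 2) \<le> 3 * r \<or> (\<exists>k\<in>J - {j}. p \<in> plane k) \<longrightarrow> cmod (\<Theta> p) \<le> e))" if j: "j \<in> J" for j
  proof -
    obtain \<kappa> where \<kappa>: "0 < \<kappa>" "\<kappa> \<le> 1" "\<And>k p. \<lbrakk>k \<in> J; k \<noteq> j; p \<in> plane k\<rbrakk> \<Longrightarrow> 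
      \<kappa> * \<bar>Re (tcoord j p)\<bar> \<le> \<bar>Im (tcoord j p)\<bar>"
      using tcoord_wedge[OF j] by blast
    have d: "cmod (\<delta> j) > 0" using nonzero(2)[OF j] by simp
    define \<rho> where "\<rho> = 3 * r / cmod (\<delta> j)"
    have "\<rho> > 0" using r d by (simp add: \<rho>_def)
    have small: "cmod (tcoord j p) \<le> \<rho> \<longleftrightarrow> cmod (p $ 2) \<le> 3 * r" for p
      using d by (simp add: tcoord_def norm_divide \<rho>_def divide_le_cancel)
    have large: "2 * \<rho> \<le> cmod (tcoord j p) \<longleftrightarrow> 6 * r \<le> cmod (p $ 2)" for p
      using d by (simp add: tcoord_def norm_divide \<rho>_def field_simps)
    have cases: "tcoord j p \<in> \<real> \<or> cmod (tcoord j p) \<le> \<rho> \<or> \<kappa> * \<bar>Re (tcoord j p)\<bar> \<le> \<bar>Im (tcoord j p)\<bar>"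
      if "p \<in> window r R" for p
      using that
    proof (cases rule: window_cases)
      case 1
      then have "cmod (p $ 2) \<le> 3 * r" using Finite_Cartesian_Product.norm_nth_le[of p 2] r by simp
      then show ?thesis using small by blast
    next
      case (2 k)
      then show ?thesis using \<kappa>(3) mem_plane_iff[OF j] by blast
    qed
    from entire_cutoff[OF compact_window entire_tcoord \<open>\<rho> > 0\<close> \<kappa>(1,2) e cases]
    obtain \<Theta> where \<Theta>: "entire \<Theta>"
      "\<And>p. \<lbrakk>p \<in> window r R; tcoord j p \<in> \<real>\<rbrakk> \<Longrightarrow> cmod (\<Theta> p) \<le> 3"
      "\<And>p. \<lbrakk>p \<in> window r R; tcoord j p \<in> \<real>; 2 * \<rho> \<le> cmod (tcoord j p)\<rbrakk> \<Longrightarrow> cmod (\<Theta> p - 1) \<le> e"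
      "\<And>p. \<lbrakk>p \<in> window r R; cmod (tcoord j p) \<le> \<rho> \<or> \<kappa> * \<bar>Re (tcoord j p)\<bar> \<le> \<bar>Im (tcoord j p)\<bar>\<rbrakk>
         \<Longrightarrow> cmod (\<Theta> p) \<le> e"
      by blast
    show ?thesis
    proof (intro exI[of _ \<Theta>] conjI ballI impI)
      fix p assume p: "p \<in> window r R"
      show "cmod (\<Theta> p) \<le> 3" using cases[OF p] \<Theta>(2,4)[OF p] e1 by linarith
      show "cmod (\<Theta> p - 1) \<le> e" if "p \<in> plane j \<and> 6 * r \<le> cmod (p $ 2)"
        using \<Theta>(3)[OF p] that large mem_plane_iff[OF j] by blast
      show "cmod (\<Theta> p) \<le> e" if "cmod (p $ 2) \<le> 3 * r \<or> (\<exists>k\<in>J - {j}. p \<in> plane k)"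
        using \<Theta>(4)[OF p] that small \<kappa>(3) by blast
    qed (rule \<Theta>(1))
  qed
  then have "\<exists>\<Theta>. \<forall>j\<in>J. entire (\<Theta> j) \<and> (\<forall>p\<in>window r R. cmod (\<Theta> j p) \<le> 3 \<and>
      (p \<in> plane j \<and> 6 * r \<le> cmod (p $ 2) \<longrightarrow> cmod (\<Theta> j p - 1) \<le> e) \<and>
      (cmod (p $ 2) \<le> 3 * r \<or> (\<exists>k\<in>J - {j}. p \<in> plane k) \<longrightarrow> cmod (\<Theta> j p) \<le> e))"
    by (intro bchoice ballI)
  then obtain \<Theta> where \<Theta>0: "\<forall>j\<in>J. entire (\<Theta> j) \<and> (\<forall>p\<in>window r R. cmod (\<Theta> j p) \<le> 3 \<and>
      (p \<in> plane j \<and> 6 * r \<le> cmod (p $ 2) \<longrightarrow> cmod (\<Theta> j p - 1) \<le> e) \<and>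
      (cmod (p $ 2) \<le> 3 * r \<or> (\<exists>k\<in>J - {j}. p \<in> plane k) \<longrightarrow> cmod (\<Theta> j p) \<le> e))" ..
  have \<Theta>: "\<And>j. j \<in> J \<Longrightarrow> entire (\<Theta> j)"
    "\<And>j p. \<lbrakk>j \<in> J; p \<in> window r R\<rbrakk> \<Longrightarrow> cmod (\<Theta> j p) \<le> 3"
    "\<And>j p. \<lbrakk>j \<in> J; p \<in> window r R; p \<in> plane j; 6 * r \<le> cmod (p $ 2)\<rbrakk> \<Longrightarrow> cmod (\<Theta> j p - 1) \<le> e"
    "\<And>j p. \<lbrakk>j \<in> J; p \<in> window r R; cmod (p $ 2) \<le> 3 * r \<or> (\<exists>k\<in>J - {j}. p \<in> plane k)\<rbrakk>
      \<Longrightarrow> cmod (\<Theta> j p) \<le> e"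
    using \<Theta>0 by blast+
  define \<phi> where "\<phi> p = 1 - (\<Sum>j\<in>J. \<Theta> j p)" for p
  show thesis
  proof (rule that[of \<phi>])
    show "entire \<phi>" unfolding \<phi>_def[abs_def] by (intro entire_diff entire_const entire_sum \<Theta>(1))
  next
    fix p assume p: "p \<in> window r R"
    have "cmod (\<Sum>j\<in>J. \<Theta> j p) \<le> of_nat (card J) * 3"
      by (rule order_trans[OF norm_sum sum_bounded_above]) (rule \<Theta>(2)[OF _ p])
    then show "cmod (\<phi> p) \<le> 1 + 3 * real (card J)"
      unfolding \<phi>_def using norm_triangle_ineq4[of 1 "\<Sum>j\<in>J. \<Theta> j p"] by simp
    show "cmod (\<phi> p - 1) \<le> \<epsilon>" if "cmod (p $ 2) \<le> 3 * r"
    proof -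
      have "cmod (\<Sum>j\<in>J. \<Theta> j p) \<le> of_nat (card J) * e"
        by (rule order_trans[OF norm_sum sum_bounded_above]) (use \<Theta>(4)[OF _ p] that in blast)
      then show ?thesis using ce by (simp add: \<phi>_def)
    qed
    show "cmod (\<phi> p) \<le> \<epsilon>" if big: "6 * r \<le> cmod (p $ 2)"
      using p
    proof (cases rule: window_cases)
      case 1
      then show ?thesis using big Finite_Cartesian_Product.norm_nth_le[of p 2] r by simp
    next
      case (2 k)
      have "\<phi> p = - (\<Sum>j\<in>J. \<Theta> j p - (if j = k then 1 else 0))"
        using finite 2(1) by (simp add: \<phi>_def sum_subtractf)
      also have "cmod \<dots> = cmod (\<Sum>j\<in>J. \<Theta> j p - (if j = k then 1 else 0))" by (rule norm_minus_cancel)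
      also have "\<dots> \<le> of_nat (card J) * e"
      proof (rule order_trans[OF norm_sum sum_bounded_above])
        fix j assume "j \<in> J"
        then show "cmod (\<Theta> j p - (if j = k then 1 else 0)) \<le> e"
          using \<Theta>(3)[OF _ p, of j] \<Theta>(4)[OF _ p, of j] 2 big by auto
      qed
      finally show ?thesis using ce by linarith
    qed
  qed
qed


lemma sum_approximable_planes:
  assumes "0 \<in> planes \<Longrightarrow> h 0 = 0" "\<And>j. j \<in> J \<Longrightarrow> entire_approximable X (\<lambda>p. if p \<in> plane j then h p else 0)"
  shows "entire_approximable X (\<lambda>p. if p \<in> planes then h p else 0)"
proof (rule entire_approximable_cong)
  show "entire_approximable X (\<lambda>p. \<Sum>j\<in>J. if p \<in> plane j then h p else 0)"
    using assms(2) by (rule entire_approximable_sum)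
qed (rule sum_over_planes[of h], rule assms(1))

text \<open>The function is split by a continuous cutoff in \<open>\<bar>p $ 2\<bar>\<close> between \<open>2 r\<close> and \<open>3 r\<close>. The outer part is
  approximated plane by plane. The inner part is approximated plane by plane on \<open>\<bar>p $ 2\<bar> \<le> 6 r\<close>, and
  the result is then multiplied by the entire cutoff near the axis. By homogeneity the radius on which
  \<open>h\<close> must vanish is a fixed multiple of \<open>r\<close>.\<close>

lemma approximation_away_from_origin:
  obtains C where "C \<ge> 1" "\<And>r R h. \<lbrakk>r > 0; continuous_on planes h;
      \<And>p. \<lbrakk>p \<in> planes; norm p \<le> C * r\<rbrakk> \<Longrightarrow> h p = 0\<rbrakk> \<Longrightarrow>
    entire_approximable (window r R) (\<lambda>p. if p \<in> planes then h p else 0)"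
proof -
  have "\<exists>C. C > 0 \<and> (\<forall>r R h. r > 0 \<longrightarrow> continuous_on (plane j) h \<longrightarrow>
      (\<forall>p\<in>plane j. cmod (p $ 2) \<le> 6 * r \<and> cmod (p $ 1) \<le> C * r \<longrightarrow> h p = 0) \<longrightarrow>
    entire_approximable {p \<in> window r R. cmod (p $ 2) \<le> 6 * r} (\<lambda>p. if p \<in> plane j then h p else 0))"
    if "j \<in> J" for j
    by (rule approximable_near_axis[OF that]) blast
  then have "\<exists>C. \<forall>j\<in>J. C j > 0 \<and> (\<forall>r R h. r > 0 \<longrightarrow> continuous_on (plane j) h \<longrightarrow>
      (\<forall>p\<in>plane j. cmod (p $ 2) \<le> 6 * r \<and> cmod (p $ 1) \<le> C j * r \<longrightarrow> h p = 0) \<longrightarrow>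
    entire_approximable {p \<in> window r R. cmod (p $ 2) \<le> 6 * r} (\<lambda>p. if p \<in> plane j then h p else 0))"
    by (intro bchoice ballI)
  then obtain C where C': "\<forall>j\<in>J. C j > 0 \<and> (\<forall>r R h. r > 0 \<longrightarrow> continuous_on (plane j) h \<longrightarrow>
      (\<forall>p\<in>plane j. cmod (p $ 2) \<le> 6 * r \<and> cmod (p $ 1) \<le> C j * r \<longrightarrow> h p = 0) \<longrightarrow>
    entire_approximable {p \<in> window r R. cmod (p $ 2) \<le> 6 * r} (\<lambda>p. if p \<in> plane j then h p else 0))" ..
  have C: "\<And>j. j \<in> J \<Longrightarrow> C j > 0" "\<And>j r R h. \<lbrakk>j \<in> J; r > 0; continuous_on (plane j) h;
      \<forall>p\<in>plane j. cmod (p $ 2) \<le> 6 * r \<and> cmod (p $ 1) \<le> C j * r \<longrightarrow> h p = 0\<rbrakk> \<Longrightarrow>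
    entire_approximable {p \<in> window r R. cmod (p $ 2) \<le> 6 * r} (\<lambda>p. if p \<in> plane j then h p else 0)"
    using C' by blast+
  define C0 where "C0 = 6 + (\<Sum>j\<in>J. C j)"
  have C0: "C j + 6 \<le> C0" if "j \<in> J" for j
    using member_le_sum[OF that _ finite, of C] C(1) by (force simp: C0_def)
  have "C0 \<ge> 6" unfolding C0_def using C(1) by (simp add: sum_nonneg less_imp_le)
  then have "C0 \<ge> 1" by simp
  moreover have "entire_approximable (window r R) (\<lambda>p. if p \<in> planes then h p else 0)"
    if r: "r > 0" and h: "continuous_on planes h" "\<And>p. \<lbrakk>p \<in> planes; norm p \<le> C0 * r\<rbrakk> \<Longrightarrow> h p = 0"
    for r R h
    unfolding entire_approximable_def
  proof (intro allI impI)
    fix e :: real assume "e > 0"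
    define \<psi> where "\<psi> p = max 0 (min 1 (3 - cmod (p $ 2) / r))" for p :: "complex^2"
    have \<psi>1: "\<psi> p = 1" if "cmod (p $ 2) \<le> 2 * r" for p
      using that r by (simp add: \<psi>_def max_def min_def field_simps)
    have \<psi>0: "\<psi> p = 0" if "3 * r \<le> cmod (p $ 2)" for p
      using that r by (simp add: \<psi>_def max_def min_def field_simps)
    have cont_\<psi>: "continuous_on X (\<lambda>p. complex_of_real (\<psi> p))" for X
      unfolding \<psi>_def using r by (intro continuous_intros) auto
    define h1 where "h1 p = (1 - complex_of_real (\<psi> p)) * h p" for p
    define h2 where "h2 p = complex_of_real (\<psi> p) * h p" for p
    have hsplit: "h p = h1 p + h2 p" for p by (simp add: h1_def h2_def algebra_simps)
    have conth: "continuous_on (plane j) h" if "j \<in> J" for j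
      using h(1) by (rule continuous_on_subset) (use that in \<open>auto simp: planes_def\<close>)
    have cont: "continuous_on (plane j) h1" "continuous_on (plane j) h2" if "j \<in> J" for j
      unfolding h1_def h2_def by (intro continuous_intros cont_\<psi> conth that)+
    have "entire_approximable (window r R) (\<lambda>p. if p \<in> planes then h1 p else 0)"
    proof (rule sum_approximable_planes)
      show "h1 0 = 0" using \<psi>1[of 0] r by (simp add: h1_def)
      show "entire_approximable (window r R) (\<lambda>p. if p \<in> plane j then h1 p else 0)" if "j \<in> J" for j
        by (rule approximable_away_from_axis[OF that r cont(1)[OF that]]) (simp add: h1_def \<psi>1)
    qed
    then obtain g1 where g1: "entire g1"
      "\<And>p. p \<in> window r R \<Longrightarrow> cmod ((if p \<in> planes then h1 p else 0) - g1 p) < e / 2"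
      using \<open>e > 0\<close> unfolding entire_approximable_def by (meson half_gt_zero)
    define F where "F = {p \<in> window r R. cmod (p $ 2) \<le> 6 * r}"
    define M where "M = 1 + 3 * real (card J)"
    have M: "M \<ge> 1" by (simp add: M_def)
    \<comment> \<open>\<open>M\<close> bounds the axis cutoff, so an error of \<open>d\<close> stays small where the cutoff is not close to 0 or 1.\<close>
    define d where "d = e / (4 * M)"
    have d: "d > 0" "M * d \<le> e / 4" "d \<le> e / 4"
      using \<open>e > 0\<close> M by (simp_all add: d_def field_simps)
    have "entire_approximable F (\<lambda>p. if p \<in> planes then h2 p else 0)"
    proof (rule sum_approximable_planes)
      show "entire_approximable F (\<lambda>p. if p \<in> plane j then h2 p else 0)" if j: "j \<in> J" for j
        unfolding F_def
      proof (rule C(2)[OF j r cont(2)[OF j]], intro ballI impI)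
        fix p assume p: "p \<in> plane j" "cmod (p $ 2) \<le> 6 * r \<and> cmod (p $ 1) \<le> C j * r"
        have "norm p \<le> (C j + 6) * r" using norm_le_coords[of p] p(2) by (simp add: algebra_simps)
        also have "\<dots> \<le> C0 * r" using C0[OF j] r by (intro mult_right_mono) auto
        finally show "h2 p = 0" using h(2) plane_in_planes[OF j p(1)] by (simp add: h2_def)
      qed
      show "h2 0 = 0" if "0 \<in> planes"
        using h(2)[OF that] r \<open>C0 \<ge> 1\<close> by (simp add: h2_def)
    qed
    then obtain g2 where g2: "entire g2"
      "\<And>p. p \<in> F \<Longrightarrow> cmod ((if p \<in> planes then h2 p else 0) - g2 p) < d"
      using d unfolding entire_approximable_def by meson
    have "bounded (g2 ` window r R)"
      by (intro compact_imp_bounded compact_continuous_image entire_imp_continuous_on g2 compact_window)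
    then obtain B where B: "B > 0" "\<And>p. p \<in> window r R \<Longrightarrow> cmod (g2 p) \<le> B"
      by (auto simp: bounded_pos)
    have "e / (8 * B) > 0" using \<open>e > 0\<close> B by simp
    from axis_cutoff[OF r this, where R = R, folded M_def]
    obtain \<phi> where \<phi>: "entire \<phi>"
      "\<And>p. p \<in> window r R \<Longrightarrow> cmod (\<phi> p) \<le> M"
      "\<And>p. \<lbrakk>p \<in> window r R; cmod (p $ 2) \<le> 3 * r\<rbrakk> \<Longrightarrow> cmod (\<phi> p - 1) \<le> e / (8 * B)"
      "\<And>p. \<lbrakk>p \<in> window r R; 6 * r \<le> cmod (p $ 2)\<rbrakk> \<Longrightarrow> cmod (\<phi> p) \<le> e / (8 * B)"
      by blast
    have eB: "a * cmod (g2 p) \<le> e / 8" if "0 \<le> a" "a \<le> e / (8 * B)" "p \<in> window r R" for a p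
    proof -
      have "a * cmod (g2 p) \<le> e / (8 * B) * B" using that B by (intro mult_mono) auto
      then show ?thesis using B(1) by simp
    qed
    have "cmod ((if p \<in> planes then h2 p else 0) - \<phi> p * g2 p) < e / 2" if p: "p \<in> window r R" for p
    proof -
      define k where "k = (if p \<in> planes then h2 p else 0)"
      have k0: "k = 0" if "3 * r \<le> cmod (p $ 2)" using \<psi>0[OF that] by (simp add: k_def h2_def)
      have k: "cmod (k - g2 p) < d" if "cmod (p $ 2) \<le> 6 * r"
        using g2(2)[of p] that p by (simp add: F_def k_def)
      consider "cmod (p $ 2) \<le> 3 * r" | "3 * r \<le> cmod (p $ 2)" "cmod (p $ 2) \<le> 6 * r" | "6 * r \<le> cmod (p $ 2)"
        by linarith
      then have "cmod (k - \<phi> p * g2 p) < e / 2"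
      proof cases
        case 1
        have "k - \<phi> p * g2 p = (k - g2 p) - (\<phi> p - 1) * g2 p" by (simp add: algebra_simps)
        then have "cmod (k - \<phi> p * g2 p) \<le> cmod (k - g2 p) + cmod (\<phi> p - 1) * cmod (g2 p)"
          by (metis norm_mult norm_triangle_ineq4)
        also have "\<dots> < d + e / 8"
          using k 1 r eB[OF norm_ge_zero \<phi>(3)[OF p 1] p] by (intro add_less_le_mono) auto
        also have "\<dots> < e / 2" using d \<open>e > 0\<close> by simp
        finally show ?thesis .
      next
        case 2
        have "cmod (g2 p) \<le> d" using k[OF 2(2)] k0[OF 2(1)] by simp
        then have "cmod (\<phi> p * g2 p) \<le> M * d"
          unfolding norm_mult using \<phi>(2)[OF p] M by (intro mult_mono) auto
        then show ?thesis using k0[OF 2(1)] d \<open>e > 0\<close> by simp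
      next
        case 3
        then have "k = 0" using k0 r by simp
        then show ?thesis using eB[OF norm_ge_zero \<phi>(4)[OF p 3] p] \<open>e > 0\<close> by (simp add: norm_mult)
      qed
      then show ?thesis by (simp add: k_def)
    qed
    note g2' = this
    have "cmod ((if p \<in> planes then h p else 0) - (g1 p + \<phi> p * g2 p)) < e" if p: "p \<in> window r R" for p
      using norm_triangle_ineq[of "(if p \<in> planes then h1 p else 0) - g1 p" "(if p \<in> planes then h2 p else 0) - \<phi> p * g2 p"]
        g1(2)[OF p] g2'[OF p] by (cases "p \<in> planes") (simp_all add: hsplit algebra_simps)
    moreover have "entire (\<lambda>p. g1 p + \<phi> p * g2 p)"
      by (intro entire_add entire_mult g1 g2 \<phi>)
    ultimately show "\<exists>g. entire g \<and> (\<forall>p\<in>window r R. cmod ((if p \<in> planes then h p else 0) - g p) < e)"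
      by (intro exI[of _ "\<lambda>p. g1 p + \<phi> p * g2 p"]) simp
  qed
  ultimately show thesis by (rule that)
qed

end

section \<open>From local to Carleman approximation\<close>

lemma positive_lower_bound_on_bounded_part:
  fixes \<epsilon> :: "'a::euclidean_space \<Rightarrow> real"
  assumes "closed S" "continuous_on S \<epsilon>" "\<And>p. p \<in> S \<Longrightarrow> 0 < \<epsilon> p"
  obtains e where "e > 0" "\<And>p. \<lbrakk>p \<in> S; norm p \<le> R\<rbrakk> \<Longrightarrow> e \<le> \<epsilon> p"
proof (cases "S \<inter> cball 0 R = {}")
  case True
  show ?thesis by (rule that[of 1]) (use True in auto)
next
  case False
  moreover have "compact (S \<inter> cball 0 R)"
    using \<open>closed S\<close> by (intro closed_Int_compact compact_cball)
  moreover have "continuous_on (S \<inter> cball 0 R) \<epsilon>"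
    using assms(2) by (rule continuous_on_subset) auto
  ultimately obtain q where q: "q \<in> S \<inter> cball 0 R" "\<forall>p\<in>S \<inter> cball 0 R. \<epsilon> q \<le> \<epsilon> p"
    using continuous_attains_inf by blast
  show ?thesis by (rule that[of "\<epsilon> q"]) (use q assms(3) in auto)
qed

lemma nearly_constant_near_origin:
  fixes f :: "'a::real_normed_vector \<Rightarrow> complex"
  assumes "closed S" "continuous_on S f" "\<delta> > 0"
  obtains c \<rho> where "\<rho> > 0" "\<rho> \<le> 1" "\<And>p. \<lbrakk>p \<in> S; norm p \<le> 2 * \<rho>\<rbrakk> \<Longrightarrow> cmod (f p - c) < \<delta>"
proof (cases "0 \<in> S")
  case True
  then obtain d where d: "d > 0" "\<forall>p\<in>S. dist p 0 < d \<longrightarrow> dist (f p) (f 0) < \<delta>"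
    using assms(2,3) unfolding continuous_on_iff by blast
  show ?thesis
    by (rule that[of "min 1 (d / 4)" "f 0"]) (use d in \<open>auto simp: dist_norm\<close>)
next
  case False
  then have "open (- S)" "0 \<in> - S" using \<open>closed S\<close> by auto
  then obtain d where d: "d > 0" "ball 0 d \<subseteq> - S" by (meson openE)
  show ?thesis
    by (rule that[of "min 1 (d / 4)" 0]) (use d in \<open>auto simp: subset_iff\<close>)
qed

text \<open>Starting from a constant, the partial sums \<open>G n\<close> are corrected on larger and larger shells: the step from
  \<open>n\<close> to \<open>n + 1\<close> replaces the error between the radii \<open>2 \<rho> n\<close> and \<open>4 \<rho> n\<close> by at most \<open>\<delta> n\<close>, adds at most \<open>\<delta> n\<close> to it anywhere within
  radius \<open>4 \<rho> n\<close>, and changes \<open>G n\<close> by at most \<open>\<delta> n\<close> on the ball of radius \<open>\<rho> n / C\<close>. The radii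
  \<open>\<rho> n = \<rho>0 2^n\<close> start so small that \<open>f\<close> is nearly constant on the part of \<open>S\<close> of norm at most
  \<open>2 \<rho>0\<close>; this takes care of the neighbourhood of the origin, where the functions to which local
  approximation applies have to vanish.\<close>

lemma Carleman_approximation_if_local:
  fixes S :: "(complex^2) set"
  assumes "closed S" "C \<ge> 1"
    and approx: "\<And>r R h \<delta>. \<lbrakk>r > 0; continuous_on S h; \<And>p. \<lbrakk>p \<in> S; norm p \<le> C * r\<rbrakk> \<Longrightarrow> h p = 0; \<delta> > 0\<rbrakk> \<Longrightarrow>
      \<exists>g. entire g \<and> (\<forall>p. norm p \<le> r \<longrightarrow> cmod (g p) < \<delta>) \<and>
        (\<forall>p\<in>S. norm p \<le> R \<longrightarrow> cmod (h p - g p) < \<delta>)"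
  shows "allows_Carleman_approximation S"
  unfolding allows_Carleman_approximation_def
proof (intro conjI allI impI)
  show "closed S" by fact
next
  fix f :: "complex^2 \<Rightarrow> complex" and \<epsilon> :: "complex^2 \<Rightarrow> real"
  assume f: "continuous_on S f" and \<epsilon>: "continuous_on S \<epsilon>" "\<forall>p\<in>S. 0 < \<epsilon> p"
  have "\<exists>e. e > 0 \<and> (\<forall>p\<in>S. norm p \<le> 4 * 2 ^ n \<longrightarrow> e \<le> \<epsilon> p)" for n :: nat
    by (rule positive_lower_bound_on_bounded_part[OF \<open>closed S\<close> \<epsilon>(1), of "4 * 2 ^ n"]) (use \<epsilon>(2) in auto)
  then have "\<exists>e. \<forall>n::nat. e n > 0 \<and> (\<forall>p\<in>S. norm p \<le> 4 * 2 ^ n \<longrightarrow> e n \<le> \<epsilon> p)" by (intro choice allI)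
  then obtain e where e: "\<And>n. e n > 0" "\<And>n p. \<lbrakk>p \<in> S; norm p \<le> 4 * 2 ^ n\<rbrakk> \<Longrightarrow> e n \<le> \<epsilon> p" by blast
  \<comment> \<open>Passing to a decreasing sequence makes the later corrections small compared to every earlier
    tolerance.\<close>
  define m where "m n = Min (e ` {..n})" for n
  have m: "m n > 0" "m n \<le> e n" for n using e(1) by (auto simp: m_def)
  have m_mono: "m k \<le> m n" if "n \<le> k" for n k :: nat
    unfolding m_def using that by (intro Min_antimono) auto
  define \<delta> where "\<delta> n = m n / 4 * (1/2) ^ n" for n
  have \<delta>: "\<delta> n > 0" for n using m(1) by (simp add: \<delta>_def)
  have \<delta>m: "\<delta> k \<le> m n / 4 * (1/2) ^ k" if "n \<le> k" for n k :: nat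
    unfolding \<delta>_def using m_mono[OF that] by (intro mult_right_mono divide_right_mono) auto
  have \<delta>m': "\<delta> n \<le> m n / 4" for n
    unfolding \<delta>_def using m(1)[of n] by (simp add: field_simps power_le_one)
  obtain c \<rho>0 where \<rho>0: "\<rho>0 > 0" "\<rho>0 \<le> 1" "\<And>p. \<lbrakk>p \<in> S; norm p \<le> 2 * \<rho>0\<rbrakk> \<Longrightarrow> cmod (f p - c) < \<delta> 0"
    using nearly_constant_near_origin[OF \<open>closed S\<close> f \<delta>] by blast
  define \<rho> where "\<rho> n = \<rho>0 * 2 ^ n" for n :: nat
  have \<rho>: "\<rho> n > 0" "\<rho> n \<le> 2 ^ n" for n using \<rho>0 by (simp_all add: \<rho>_def)
  have \<rho>_mono: "\<rho> n \<le> \<rho> k" if "n \<le> k" for n k :: nat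
    unfolding \<rho>_def using \<rho>0(1) that by (intro mult_left_mono power_increasing) auto
  define \<psi> where "\<psi> n p = max 0 (min 1 (norm p / \<rho> n - 1))" for n :: nat and p :: "complex^2"
  have \<psi>0: "\<psi> n p = 0" if "norm p \<le> \<rho> n" for n :: nat and p :: "complex^2"
    using that \<rho>(1)[of n] by (simp add: \<psi>_def max_def min_def field_simps)
  have \<psi>1: "\<psi> n p = 1" if "2 * \<rho> n \<le> norm p" for n :: nat and p :: "complex^2"
    using that \<rho>(1)[of n] by (simp add: \<psi>_def max_def min_def field_simps)
  have \<psi>01: "0 \<le> \<psi> n p" "\<psi> n p \<le> 1" for n :: nat and p :: "complex^2" by (auto simp: \<psi>_def)
  have cont_\<psi>: "continuous_on S (\<lambda>p. complex_of_real (\<psi> n p))" for n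
    unfolding \<psi>_def using \<rho>(1)[of n] by (intro continuous_intros) auto
  define Q where "Q n G G' \<longleftrightarrow> (\<forall>p. norm p \<le> \<rho> n / C \<longrightarrow> cmod (G' p - G p) < \<delta> n) \<and>
     (\<forall>p\<in>S. norm p \<le> 4 * \<rho> n \<longrightarrow> cmod (complex_of_real (\<psi> n p) * (f p - G p) - (G' p - G p)) < \<delta> n)"
    for n :: nat and G G' :: "complex^2 \<Rightarrow> complex"
  have "\<exists>G. \<forall>n. (entire (G n) \<and> (n = 0 \<longrightarrow> G n = (\<lambda>p. c))) \<and> Q n (G n) (G (Suc n))"
  proof (rule dependent_nat_choice)
    show "\<exists>G. entire G \<and> (0 = (0::nat) \<longrightarrow> G = (\<lambda>p. c))" by (intro exI[of _ "\<lambda>p. c"]) simp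
  next
    fix G and n :: nat assume "entire G \<and> (n = 0 \<longrightarrow> G = (\<lambda>p. c))"
    then have G: "entire G" by blast
    have "\<exists>g. entire g \<and> (\<forall>p. norm p \<le> \<rho> n / C \<longrightarrow> cmod (g p) < \<delta> n) \<and>
        (\<forall>p\<in>S. norm p \<le> 4 * \<rho> n \<longrightarrow> cmod (complex_of_real (\<psi> n p) * (f p - G p) - g p) < \<delta> n)"
    proof (rule approx)
      show "\<rho> n / C > 0" using \<rho>(1)[of n] \<open>C \<ge> 1\<close> by simp
      show "continuous_on S (\<lambda>p. complex_of_real (\<psi> n p) * (f p - G p))"
        by (intro continuous_intros cont_\<psi> f entire_imp_continuous_on G)
      show "complex_of_real (\<psi> n p) * (f p - G p) = 0" if "norm p \<le> C * (\<rho> n / C)" for p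
        using that \<psi>0[of p n] \<open>C \<ge> 1\<close> by simp
    qed (rule \<delta>)
    then obtain g where g: "entire g" "\<forall>p. norm p \<le> \<rho> n / C \<longrightarrow> cmod (g p) < \<delta> n"
        "\<forall>p\<in>S. norm p \<le> 4 * \<rho> n \<longrightarrow> cmod (complex_of_real (\<psi> n p) * (f p - G p) - g p) < \<delta> n"
      by blast
    then show "\<exists>G'. (entire G' \<and> (Suc n = 0 \<longrightarrow> G' = (\<lambda>p. c))) \<and> Q n G G'"
      using entire_add[OF G g(1)] by (intro exI[of _ "\<lambda>p. G p + g p"]) (simp add: Q_def)
  qed
  then obtain G where G: "\<And>n. entire (G n)" "G 0 = (\<lambda>p. c)" and QG: "\<And>n. Q n (G n) (G (Suc n))"
    by blast
  define g where "g n p = G (Suc n) p - G n p" for n :: nat and p :: "complex^2"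
  have g_small: "cmod (g n p) \<le> m 0 / 4 * (1/2) ^ n" if "norm p \<le> \<rho>0 / C * 2 ^ n" for n :: nat and p :: "complex^2"
  proof -
    have "norm p \<le> \<rho> n / C" using that by (simp add: \<rho>_def)
    then have "cmod (g n p) < \<delta> n" using QG[of n] unfolding Q_def g_def by blast
    with \<delta>m[of 0 n] show ?thesis by simp
  qed
  have ent_g: "entire (g n)" for n unfolding g_def[abs_def] by (intro entire_diff G)
  have pos: "\<rho>0 / C > 0" using \<rho>0(1) \<open>C \<ge> 1\<close> by simp
  note series = entire_series[OF ent_g pos g_small]
  define H where "H p = c + (\<Sum>n. g n p)" for p
  have "entire H" unfolding H_def[abs_def] by (intro entire_add entire_const series(1))
  have lim: "(\<lambda>n. G n p) \<longlonglongrightarrow> H p" for p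
  proof -
    have "(\<Sum>i<n. g i p) = G n p - c" for n
      using sum_lessThan_telescope[of "\<lambda>i. G i p" n] by (simp add: g_def G(2))
    then have "(\<lambda>n. G n p - c) \<longlonglongrightarrow> (\<Sum>n. g n p)"
      using summable_LIMSEQ[OF series(2), of p] by simp
    from tendsto_add[OF tendsto_const[of c] this] show ?thesis by (simp add: H_def)
  qed
  have step: "cmod (f p - G (Suc n) p) \<le> (1 - \<psi> n p) * cmod (f p - G n p) + \<delta> n"
    if "p \<in> S" "norm p \<le> 4 * \<rho> n" for n :: nat and p :: "complex^2"
  proof -
    have "f p - G (Suc n) p = complex_of_real (1 - \<psi> n p) * (f p - G n p)
        + (complex_of_real (\<psi> n p) * (f p - G n p) - (G (Suc n) p - G n p))"
      by (simp add: algebra_simps)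
    then have "cmod (f p - G (Suc n) p) \<le> cmod (complex_of_real (1 - \<psi> n p) * (f p - G n p)) +
       cmod (complex_of_real (\<psi> n p) * (f p - G n p) - (G (Suc n) p - G n p))"
      by (metis norm_triangle_ineq)
    also have "cmod (complex_of_real (1 - \<psi> n p) * (f p - G n p)) = (1 - \<psi> n p) * cmod (f p - G n p)"
      unfolding norm_mult norm_of_real using \<psi>01[of n p] by simp
    also have "cmod (complex_of_real (\<psi> n p) * (f p - G n p) - (G (Suc n) p - G n p)) \<le> \<delta> n"
      using QG[of n] that unfolding Q_def by (meson less_imp_le)
    finally show ?thesis by simp
  qed
  have final: "cmod (f p - H p) < \<epsilon> p"
    if p: "p \<in> S" "norm p \<le> 4 * \<rho> s" "norm p \<le> 4 * \<rho> j" and "j \<le> s"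
      and start: "cmod (f p - G s p) \<le> m j / 4" for p j s
  proof -
    have "cmod (f p - G (s + i) p) \<le> m j / 4 + (\<Sum>l<i. m j / 4 * (1/2) ^ l)" for i
    proof (induction i)
      case 0
      then show ?case using start by simp
    next
      case (Suc i)
      have "norm p \<le> 4 * \<rho> (s + i)" using p(2) \<rho>_mono[of s "s + i"] by simp
      then have "cmod (f p - G (Suc (s + i)) p) \<le> (1 - \<psi> (s + i) p) * cmod (f p - G (s + i) p) + \<delta> (s + i)"
        by (rule step[OF p(1)])
      also have "\<dots> \<le> 1 * cmod (f p - G (s + i) p) + \<delta> (s + i)"
        using \<psi>01[of "s + i" p] by (intro add_right_mono mult_right_mono) auto
      also have "\<delta> (s + i) \<le> m j / 4 * (1/2) ^ (s + i)" using \<open>j \<le> s\<close> by (intro \<delta>m) simp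
      also have "\<dots> \<le> m j / 4 * (1/2) ^ i"
        using m(1)[of j] by (intro mult_left_mono power_decreasing) auto
      finally show ?case using Suc.IH by simp
    qed
    also have "m j / 4 + (\<Sum>l<i. m j / 4 * (1/2) ^ l) \<le> m j * (3/4)" for i
    proof -
      have "(\<Sum>l<i. (1/2::real) ^ l) \<le> 2" by (simp add: sum_gp_strict)
      then have "m j / 4 * (\<Sum>l<i. (1/2::real) ^ l) \<le> m j / 4 * 2"
        using m(1)[of j] by (intro mult_left_mono) auto
      then show ?thesis unfolding sum_distrib_left[symmetric] by linarith
    qed
    finally have bound: "cmod (f p - G (s + i) p) \<le> m j * (3/4)" for i .
    have "(\<lambda>i. cmod (f p - G (s + i) p)) \<longlonglongrightarrow> cmod (f p - H p)"
      using LIMSEQ_ignore_initial_segment[OF lim[of p], of s]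
      by (intro tendsto_intros) (simp add: add.commute)
    then have "cmod (f p - H p) \<le> m j * (3/4)"
      by (rule LIMSEQ_le_const2) (use bound in blast)
    also have "\<dots> < m j" using m(1)[of j] by simp
    also have "m j \<le> e j" by (rule m)
    also have "e j \<le> \<epsilon> p" using p(1,3) \<rho>(2)[of j] by (intro e(2)) auto
    finally show ?thesis .
  qed
  have "cmod (f p - H p) < \<epsilon> p" if p: "p \<in> S" for p
  proof (cases "norm p \<le> 2 * \<rho>0")
    case True
    then show ?thesis
      using \<rho>0(1) \<rho>0(3)[OF p True] \<delta>m'[of 0] by (intro final[OF p, of 0 0]) (simp_all add: \<rho>_def G(2))
  next
    case False
    obtain N where "norm p / (4 * \<rho>0) < 2 ^ N" using real_arch_pow[of 2] by auto
    then have N: "norm p \<le> 4 * \<rho> N" using \<rho>0(1) by (simp add: \<rho>_def field_simps)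
    \<comment> \<open>The step with this index acts fully at \<open>p\<close>, since \<open>2 \<rho> n \<le> norm p \<le> 4 \<rho> n\<close>.\<close>
    define n where "n = (LEAST n. norm p \<le> 4 * \<rho> n)"
    have n: "norm p \<le> 4 * \<rho> n" unfolding n_def using N by (rule LeastI)
    have "2 * \<rho> n \<le> norm p"
    proof (cases n)
      case 0
      then show ?thesis using False by (simp add: \<rho>_def)
    next
      case (Suc k)
      then have "\<not> norm p \<le> 4 * \<rho> k" using not_less_Least[of k "\<lambda>n. norm p \<le> 4 * \<rho> n"] by (simp add: n_def)
      then show ?thesis by (simp add: Suc \<rho>_def)
    qed
    then have "cmod (f p - G (Suc n) p) \<le> \<delta> n" using step[OF p n] \<psi>1 by simp
    then show ?thesis
      using n \<delta>m'[of n] \<rho>_mono[of n "Suc n"] by (intro final[OF p, of "Suc n" n]) auto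
  qed
  with \<open>entire H\<close> show "\<exists>g. entire g \<and> (\<forall>p\<in>S. cmod (f p - g p) < \<epsilon> p)"
    by (intro exI[of _ H]) simp
qed

section \<open>Common eigenvectors\<close>

definition cross2 :: "real^2 \<Rightarrow> real^2 \<Rightarrow> real" where
  "cross2 x y = x $ 1 * y $ 2 - x $ 2 * y $ 1"

text \<open>The zero vector is included: in \<open>shared_eigenvector\<close> the second candidate can vanish, and then \<open>A\<close> is scalar.\<close>

definition eigen :: "real^2^2 \<Rightarrow> real^2 \<Rightarrow> bool" where
  "eigen A x \<longleftrightarrow> (\<exists>a. A *v x = a *\<^sub>R x)"

lemma cross2_expand:
  "cross2 (a *\<^sub>R e + b *\<^sub>R f) (c *\<^sub>R e + d *\<^sub>R f) = (a * d - b * c) * cross2 e f"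
  by (simp add: cross2_def algebra_simps)

lemma cross2_swap: "cross2 y x = - cross2 x y" and cross2_self [simp]: "cross2 x x = 0"
  by (simp_all add: cross2_def)

lemma cross2_zero [simp]: "cross2 0 x = 0" "cross2 x 0 = 0"
  by (simp_all add: cross2_def)

lemma cross2_scale [simp]: "cross2 (a *\<^sub>R x) y = a * cross2 x y" "cross2 x (a *\<^sub>R y) = a * cross2 x y"
  by (simp_all add: cross2_def algebra_simps)

lemma cross2_basis:
  assumes "cross2 e f \<noteq> 0"
  obtains a b where "x = a *\<^sub>R e + b *\<^sub>R f"
proof (rule that)
  have "cross2 e f *\<^sub>R x = cross2 x f *\<^sub>R e + cross2 e x *\<^sub>R f"
    by (simp add: vec_eq_iff forall_2 cross2_def algebra_simps)
  then have "(1 / cross2 e f) *\<^sub>R (cross2 e f *\<^sub>R x) =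
      (1 / cross2 e f) *\<^sub>R (cross2 x f *\<^sub>R e + cross2 e x *\<^sub>R f)" by simp
  then show "x = (cross2 x f / cross2 e f) *\<^sub>R e + (cross2 e x / cross2 e f) *\<^sub>R f"
    using assms by (simp add: scaleR_add_right)
qed

lemma cross2_span:
  assumes "cross2 e f \<noteq> 0"
  shows "range (\<lambda>(s, t). s *\<^sub>R e + t *\<^sub>R f) = UNIV"
  using cross2_basis[OF assms] by (auto simp: image_iff) metis

lemma cross2_complement:
  assumes "e \<noteq> 0"
  obtains f where "cross2 e f \<noteq> 0"
proof
  have "(e $ 1)\<^sup>2 + (e $ 2)\<^sup>2 \<noteq> 0"
    using assms unfolding sum_power2_eq_zero_iff by (auto simp: vec_eq_iff forall_2)
  then show "cross2 e (vector [- (e $ 2), e $ 1]) \<noteq> 0"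
    by (simp add: cross2_def power2_eq_square)
qed

lemma cross2_eq_0_imp_parallel:
  assumes "cross2 x y = 0" "x \<noteq> 0" "y \<noteq> 0"
  obtains a where "a \<noteq> 0" "y = a *\<^sub>R x"
proof (cases "x $ 1 = 0")
  case True
  then have x2: "x $ 2 \<noteq> 0" using assms(2) by (auto simp: vec_eq_iff forall_2)
  then have "y = (y $ 2 / x $ 2) *\<^sub>R x" using True assms(1)
    by (simp add: vec_eq_iff forall_2 cross2_def)
  then show thesis using that[of "y $ 2 / x $ 2"] assms(3) by (metis scaleR_zero_left)
next
  case False
  then have "y = (y $ 1 / x $ 1) *\<^sub>R x" using assms(1)
    by (simp add: vec_eq_iff forall_2 cross2_def field_simps)
  then show thesis using that[of "y $ 1 / x $ 1"] assms(3) by (metis scaleR_zero_left)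
qed

lemma eigen_scaleR:
  assumes "a \<noteq> 0"
  shows "eigen A (a *\<^sub>R x) \<longleftrightarrow> eigen A x"
proof -
  have "A *v (a *\<^sub>R x) = t *\<^sub>R (a *\<^sub>R x) \<longleftrightarrow> A *v x = t *\<^sub>R x" for t
    unfolding matrix_vector_mult_scaleR scaleR_left_commute[of t]
    using assms by (simp only: scaleR_cancel_left) simp
  then show ?thesis by (simp add: eigen_def)
qed

lemma eigen_parallel: "\<lbrakk>cross2 x y = 0; x \<noteq> 0; y \<noteq> 0; eigen A x\<rbrakk> \<Longrightarrow> eigen A y"
  by (erule cross2_eq_0_imp_parallel) (simp_all add: eigen_scaleR)

lemma det_cross2: "det C * cross2 e f = cross2 (C *v e) (C *v f)"
  by (simp add: det_2 cross2_def matrix_vector_mult_def sum_2 algebra_simps)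

lemma trace_cross2: "trace X * cross2 e f = cross2 (X *v e) f + cross2 e (X *v f)"
  by (simp add: trace_def cross2_def matrix_vector_mult_def sum_2 algebra_simps)

lemma matrix_eq_on_basis:
  assumes "cross2 e f \<noteq> 0" "A *v e = B *v e" "A *v f = B *v f"
  shows "A = B"
  unfolding matrix_eq
proof
  fix x
  obtain a b where "x = a *\<^sub>R e + b *\<^sub>R f" using cross2_basis[OF assms(1)] .
  then show "A *v x = B *v x"
    by (simp add: matrix_vector_right_distrib matrix_vector_mult_scaleR assms(2,3))
qed

lemma commutator_mult: "commutator A B *v x = A *v (B *v x) - B *v (A *v x)"
  by (simp add: commutator_def matrix_vector_mult_diff_rdistrib matrix_vector_mul_assoc)

lemma commutator_swap: "commutator B A = - commutator A B"
  by (simp add: commutator_def)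

lemma commutator_eq_0_if_two_eigenvectors:
  assumes "cross2 e f \<noteq> 0" "eigen A e" "eigen A f" "eigen B e" "eigen B f"
  shows "commutator A B = 0"
  using assms by (intro matrix_eq_on_basis[of e f])
    (auto simp: commutator_mult eigen_def matrix_vector_mult_scaleR mult.commute)

text \<open>In the basis \<open>e, f\<close> the matrix \<open>A\<close> is triangular with second eigenvector \<open>q e + (s - p) f\<close>, and
  \<open>det [A, B]\<close> factors, up to sign, into the cross products that express that \<open>e\<close>, respectively that second
  vector, is an eigenvector of \<open>B\<close>.\<close>

lemma shared_eigenvector:
  assumes ef: "cross2 e f \<noteq> 0" and A: "A *v e = p *\<^sub>R e" "A *v f = q *\<^sub>R e + s *\<^sub>R f"
    and det: "det (commutator A B) = 0"
  shows "eigen B e \<or> eigen B (q *\<^sub>R e + (s - p) *\<^sub>R f)"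
proof -
  obtain x z where Be: "B *v e = x *\<^sub>R e + z *\<^sub>R f" using cross2_basis[OF ef] .
  obtain y w where Bf: "B *v f = y *\<^sub>R e + w *\<^sub>R f" using cross2_basis[OF ef] .
  have Ce: "commutator A B *v e = (z * q) *\<^sub>R e + (z * (s - p)) *\<^sub>R f"
    by (simp add: commutator_mult A Be Bf matrix_vector_right_distrib matrix_vector_mult_scaleR algebra_simps)
  have Cf: "commutator A B *v f = (y * (p - s) + q * (w - x)) *\<^sub>R e + (- q * z) *\<^sub>R f"
    by (simp add: commutator_mult A Be Bf matrix_vector_right_distrib matrix_vector_mult_scaleR algebra_simps)
  have "0 = cross2 (commutator A B *v e) (commutator A B *v f)"
    using det_cross2[of "commutator A B" e f] det by simp
  also have "\<dots> = - z * (q * (q * z + (s - p) * w) - (s - p) * (q * x + (s - p) * y)) * cross2 e f"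
    unfolding Ce Cf cross2_expand by (simp add: algebra_simps)
  finally consider "z = 0" | "q * (q * z + (s - p) * w) = (s - p) * (q * x + (s - p) * y)"
    using ef by auto
  then show ?thesis
  proof cases
    case 1
    then show ?thesis using Be by (auto simp: eigen_def)
  next
    case 2
    have B: "B *v (q *\<^sub>R e + (s - p) *\<^sub>R f) = (q * x + (s - p) * y) *\<^sub>R e + (q * z + (s - p) * w) *\<^sub>R f"
      by (simp add: Be Bf matrix_vector_right_distrib matrix_vector_mult_scaleR scaleR_add_right scaleR_add_left)
    have "\<exists>t. q * x + (s - p) * y = t * q \<and> q * z + (s - p) * w = t * (s - p)"
    proof (cases "q = 0")
      case True
      show ?thesis
      proof (cases "s = p")
        case False
        then show ?thesis using 2 True 
          by (intro exI[of _ "(q * z + (s - p) * w) / (s - p)"]) auto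
      qed (use True in auto)
    next
      case False
      then show ?thesis using 2 
        by (intro exI[of _ "(q * x + (s - p) * y) / q"]) (simp add: field_simps)
    qed
    then obtain t where "q * x + (s - p) * y = t * q" "q * z + (s - p) * w = t * (s - p)" by blast
    then have "B *v (q *\<^sub>R e + (s - p) *\<^sub>R f) = t *\<^sub>R (q *\<^sub>R e + (s - p) *\<^sub>R f)"
      unfolding B by (simp add: scaleR_add_right)
    then show ?thesis by (auto simp: eigen_def)
  qed
qed

text \<open>If the discriminant were negative, one of the conjugate roots of the characteristic polynomial would be
  a nonreal element of the spectrum.\<close>

lemma real_eigenvector_exists:
  assumes "spec A \<subseteq> \<real>"
  obtains e a where "e \<noteq> 0" "A *v e = a *\<^sub>R e"
proof -
  define p q r s where pqrs: "p = A $ 1 $ 1" "q = A $ 1 $ 2" "r = A $ 2 $ 1" "s = A $ 2 $ 2"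
  define D where "D = (p - s)\<^sup>2 + 4 * q * r"
  have Ax: "(A *v x) $ 1 = p * x $ 1 + q * x $ 2" "(A *v x) $ 2 = r * x $ 1 + s * x $ 2" for x
    by (simp_all add: pqrs matrix_vector_mult_def sum_2)
  have "D \<ge> 0"
  proof (rule ccontr)
    assume "\<not> D \<ge> 0"
    then have D: "D < 0" by simp
    then have q: "q \<noteq> 0" by (auto simp: D_def)
    define d where "d = sqrt (- D)"
    have d: "d > 0" "d\<^sup>2 = - D" using D by (simp_all add: d_def)
    define \<mu> where "\<mu> = Complex ((p + s) / 2) (d / 2)"
    have key: "complex_of_real r * complex_of_real q + complex_of_real s * (\<mu> - complex_of_real p)
        = \<mu> * (\<mu> - complex_of_real p)"
      using d(2) by (simp add: \<mu>_def complex_eq_iff D_def power2_eq_square field_simps)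
    define v :: "complex^2" where "v = vector [complex_of_real q, \<mu> - complex_of_real p]"
    have "v $ 1 \<noteq> 0" using q by (simp add: v_def)
    then have "v \<noteq> 0" by auto
    moreover have "cmat A *v v = \<mu> *s v"
      using key by (simp add: vec_eq_iff forall_2 cmat_def map_matrix_def matrix_vector_mult_def sum_2 v_def pqrs algebra_simps)
    ultimately have "\<mu> \<in> spec A" by (auto simp: spec_def)
    then show False using assms d(1) by (auto simp: \<mu>_def complex_is_Real_iff)
  qed
  define a where "a = (p + s + sqrt D) / 2"
  have a: "(a - p) * (a - s) = q * r"
  proof -
    have "(a - p) * (a - s) = ((sqrt D)\<^sup>2 - (p - s)\<^sup>2) / 4"
      by (simp add: a_def power2_eq_square field_simps)
    then show ?thesis using \<open>D \<ge> 0\<close> by (simp add: D_def)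
  qed
  show thesis
  proof (cases "q = 0 \<and> a = p")
    case False
    show ?thesis
    proof (rule that[of "vector [q, a - p]" a])
      show "(vector [q, a - p] :: real^2) \<noteq> 0" using False by (auto simp: vec_eq_iff forall_2)
      show "A *v vector [q, a - p] = a *\<^sub>R vector [q, a - p]"
        using a by (simp add: vec_eq_iff forall_2 Ax algebra_simps)
    qed
  next
    case True
    show ?thesis
    proof (cases "r = 0 \<and> a = s")
      case False
      show ?thesis
      proof (rule that[of "vector [a - s, r]" a])
        show "(vector [a - s, r] :: real^2) \<noteq> 0" using False by (auto simp: vec_eq_iff forall_2)
        show "A *v vector [a - s, r] = a *\<^sub>R vector [a - s, r]"
          using a True by (simp add: vec_eq_iff forall_2 Ax algebra_simps)
      qed
    next
      case r: True
      show ?thesis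
        by (rule that[of "vector [1, 0]" a])
          (use True r in \<open>auto simp: vec_eq_iff forall_2 Ax\<close>)
    qed
  qed
qed

text \<open>Here \<open>A\<close> has the eigenlines of \<open>e\<close> and \<open>f\<close>, while \<open>B\<close> keeps only \<open>f\<close> if \<open>r \<noteq> 0\<close> and \<open>C\<close> keeps only \<open>e\<close> if
  \<open>q \<noteq> 0\<close>; so the trace is nonzero for a triangle of eigenlines.\<close>

lemma triangle_trace:
  assumes ef: "cross2 e f \<noteq> 0"
    and A: "A *v e = p *\<^sub>R e" "A *v f = s *\<^sub>R f"
    and B: "B *v e = pb *\<^sub>R e + r *\<^sub>R f" "B *v f = sb *\<^sub>R f"
    and C: "C *v e = pc *\<^sub>R e" "C *v f = q *\<^sub>R e + sc *\<^sub>R f"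
  shows "trace (A ** B ** C - C ** B ** A) = r * q * (s - p)"
proof -
  define X where "X = A ** B ** C - C ** B ** A"
  have X: "X *v x = A *v (B *v (C *v x)) - C *v (B *v (A *v x))" for x
    by (simp add: X_def matrix_vector_mult_diff_rdistrib matrix_vector_mul_assoc matrix_mul_assoc)
  have Xe: "X *v e = (- p * r * q) *\<^sub>R e + (pc * r * s - p * r * sc) *\<^sub>R f"
    by (simp add: X A B C matrix_vector_right_distrib matrix_vector_mult_scaleR algebra_simps)
  have Xf: "X *v f = (q * pb * p - s * sb * q) *\<^sub>R e + (q * r * s) *\<^sub>R f"
    by (simp add: X A B C matrix_vector_right_distrib matrix_vector_mult_scaleR algebra_simps)
  have "cross2 (X *v e) f = - p * r * q * cross2 e f"
    unfolding Xe using cross2_expand[of "- p * r * q" e "pc * r * s - p * r * sc" f 0 1] by simp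
  moreover have "cross2 e (X *v f) = q * r * s * cross2 e f"
    unfolding Xf using cross2_expand[of 1 e 0 f "q * pb * p - s * sb * q" "q * r * s"] by simp
  ultimately have "trace X * cross2 e f = (r * q * (s - p)) * cross2 e f"
    unfolding trace_cross2[of X e f] by (simp add: algebra_simps)
  then show ?thesis using ef by (simp add: X_def)
qed

lemma eigen_dichotomy:
  assumes ef: "cross2 e f \<noteq> 0" and A: "A *v e = p *\<^sub>R e" "A *v f = s *\<^sub>R f" "p \<noteq> s"
    and "det (commutator A B) = 0"
  shows "eigen B e \<or> eigen B f"
  using shared_eigenvector[of e f A p 0 s B] assms eigen_scaleR[of "s - p" B f] by simp

text \<open>If every matrix has two of three fixed eigenlines, then two matrices with the same pair commute, so a
  reduction contains at most one matrix for each of the three pairs.\<close>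

lemma triangle_reduced_length:
  assumes abc: "a \<in> {1..m}" "b \<in> {1..m}" "c \<in> {1..m}"
    and red: "reduced A {a, b, c}" "a \<noteq> b" "b \<noteq> c" "a \<noteq> c"
    and indep: "cross2 e1 e2 \<noteq> 0" "cross2 e2 e3 \<noteq> 0" "cross2 e1 e3 \<noteq> 0"
    and two: "\<And>k. k \<in> {1..m} \<Longrightarrow> (eigen (A k) e1 \<and> eigen (A k) e2) \<or>
      (eigen (A k) e2 \<and> eigen (A k) e3) \<or> (eigen (A k) e1 \<and> eigen (A k) e3)"
  shows "reduced_length A m = 3" "maximal_reduction A m {a, b, c}"
proof -
  have abc_red: "is_reduction A m {a, b, c}" "card {a, b, c} = 3"
    using abc red by (auto simp: is_reduction_def)
  have le3: "card I \<le> 3" if I: "is_reduction A m I" for I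
  proof -
    define kind where "kind k = (if eigen (A k) e1 \<and> eigen (A k) e2 then 0
      else if eigen (A k) e2 \<and> eigen (A k) e3 then 1 else 2 :: nat)" for k
    have "inj_on kind I"
    proof (rule inj_onI, rule ccontr)
      fix j k assume jk: "j \<in> I" "k \<in> I" "kind j = kind k" "j \<noteq> k"
      then have m: "j \<in> {1..m}" "k \<in> {1..m}" and ne: "commutator (A j) (A k) \<noteq> 0"
        using I by (auto simp: is_reduction_def reduced_def)
      have "commutator (A j) (A k) = 0"
        using two[OF m(1)] two[OF m(2)] jk(3) indep
        by (auto simp: kind_def split: if_splits intro: commutator_eq_0_if_two_eigenvectors)
      with ne show False by simp
    qed
    moreover have "kind ` I \<subseteq> {0, 1, 2}" by (auto simp: kind_def)
    ultimately have "card I \<le> card {0, 1, 2 :: nat}" by (intro card_inj_on_le) auto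
    then show ?thesis by simp
  qed
  show "reduced_length A m = 3"
    unfolding reduced_length_def
  proof (rule Greatest_equality)
    show "0 < (3::nat) \<and> (\<exists>I. is_reduction A m I \<and> card I = 3)"
      by (intro conjI exI[of _ "{a, b, c}"] abc_red) simp
  qed (use le3 in auto)
  then show "maximal_reduction A m {a, b, c}"
    using abc_red by (simp add: maximal_reduction_def)
qed

text \<open>Let \<open>A a\<close> be nonscalar with eigenvectors \<open>e\<close> and \<open>e'\<close>; each matrix shares one of them. If neither is
  common to all, some \<open>A b\<close> lacks \<open>e\<close> and some \<open>A c\<close> lacks \<open>e'\<close>. The eigenvector \<open>e3\<close> that these two share
  completes a triangle, and sharing an eigenvector with each of the three matrices forces every matrix to
  have two of the three eigenlines. Then the trace hypothesis applies to \<open>{a, b, c}\<close> and is violated.\<close>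

lemma common_eigenvector:
  fixes A :: "nat \<Rightarrow> real^2^2"
  assumes spec: "\<And>j. j \<in> {1..m} \<Longrightarrow> spec (A j) \<subseteq> \<real>"
    and det: "\<And>j k. 1 \<le> j \<Longrightarrow> j < k \<Longrightarrow> k \<le> m \<Longrightarrow> det (commutator (A j) (A k)) = 0"
    and trace: "\<And>I a b c. reduced_length A m = 3 \<Longrightarrow> maximal_reduction A m I \<Longrightarrow>
           a \<in> I \<Longrightarrow> b \<in> I \<Longrightarrow> c \<in> I \<Longrightarrow>
           trace (A a ** A b ** A c - A c ** A b ** A a) = 0"
  obtains e where "e \<noteq> 0" "\<And>j. j \<in> {1..m} \<Longrightarrow> eigen (A j) e"
proof (cases "\<forall>j\<in>{1..m}. \<forall>x. eigen (A j) x")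
  case True
  then show thesis using that[of "axis 1 1"] by (auto simp: axis_eq_0_iff)
next
  case False
  then obtain a x where a: "a \<in> {1..m}" "\<not> eigen (A a) x" by blast
  have det': "det (commutator (A j) (A k)) = 0" if "j \<in> {1..m}" "k \<in> {1..m}" for j k
  proof -
    have neg: "det (- C) = det C" for C :: "real^2^2" by (simp add: det_2)
    consider "j < k" | "j = k" | "k < j" by linarith
    then show ?thesis
    proof cases
      case 2
      then show ?thesis by (simp add: commutator_def det_2)
    next
      case 3
      then show ?thesis using det[of k j] that commutator_swap[of "A j" "A k"] neg by simp
    qed (use det that in auto)
  qed
  obtain e p where e: "e \<noteq> 0" "A a *v e = p *\<^sub>R e" using real_eigenvector_exists[OF spec[OF a(1)]] .
  obtain f where ef: "cross2 e f \<noteq> 0" using cross2_complement[OF e(1)] .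
  obtain q s where Af: "A a *v f = q *\<^sub>R e + s *\<^sub>R f" using cross2_basis[OF ef] .
  define e' where "e' = q *\<^sub>R e + (s - p) *\<^sub>R f"
  have Ae': "A a *v e' = s *\<^sub>R e'"
    unfolding e'_def by (simp add: e Af matrix_vector_right_distrib matrix_vector_mult_scaleR algebra_simps)
  have "e' \<noteq> 0"
  proof
    assume "e' = 0"
    then have "cross2 e' f = 0" "cross2 e e' = 0" by simp_all
    then have qs: "q = 0" "s = p"
      using ef cross2_expand[of q e "s - p" f 0 1] cross2_expand[of 1 e 0 f q "s - p"]
      by (auto simp: e'_def)
    obtain \<alpha> \<beta> where "x = \<alpha> *\<^sub>R e + \<beta> *\<^sub>R f" using cross2_basis[OF ef] .
    then have "A a *v x = p *\<^sub>R x"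
      by (simp add: e Af qs matrix_vector_right_distrib matrix_vector_mult_scaleR algebra_simps)
    with a(2) show False by (auto simp: eigen_def)
  qed
  have e_or_e': "eigen (A k) e \<or> eigen (A k) e'" if "k \<in> {1..m}" for k
    unfolding e'_def by (rule shared_eigenvector[OF ef e(2) Af det'[OF a(1) that]])
  show thesis
  proof (rule ccontr)
    assume "\<not> thesis"
    with that have "\<not> (\<forall>j\<in>{1..m}. eigen (A j) e)" "\<not> (\<forall>j\<in>{1..m}. eigen (A j) e')"
      using e(1) \<open>e' \<noteq> 0\<close> by blast+
    then obtain b c where b: "b \<in> {1..m}" "\<not> eigen (A b) e" and c: "c \<in> {1..m}" "\<not> eigen (A c) e'"
      by blast
    have be': "eigen (A b) e'" and ce: "eigen (A c) e" using e_or_e' b c by blast+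
    have ee': "cross2 e e' \<noteq> 0"
      using eigen_parallel[of e e'] eigen_parallel[of e' e] cross2_swap[of e e'] be' b(2) e(1) \<open>e' \<noteq> 0\<close> by auto
    then have e'e: "cross2 e' e \<noteq> 0" using cross2_swap[of e' e] by simp
    have "s \<noteq> p" using ee' cross2_expand[of 1 e 0 f q "s - p"] by (auto simp: e'_def)
    obtain sb where B': "A b *v e' = sb *\<^sub>R e'" using be' by (auto simp: eigen_def)
    obtain pb r where B: "A b *v e = pb *\<^sub>R e + r *\<^sub>R e'" using cross2_basis[OF ee'] .
    obtain pc where C: "A c *v e = pc *\<^sub>R e" using ce by (auto simp: eigen_def)
    obtain qc sc where C': "A c *v e' = qc *\<^sub>R e + sc *\<^sub>R e'" using cross2_basis[OF ee'] .
    have r: "r \<noteq> 0" using b(2) B by (auto simp: eigen_def)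
    have qc: "qc \<noteq> 0" using c(2) C' by (auto simp: eigen_def)
    have trace_ne: "trace (A a ** A b ** A c - A c ** A b ** A a) \<noteq> 0"
      using triangle_trace[OF ee' e(2) Ae' B B' C C'] r qc \<open>s \<noteq> p\<close> by simp
    define e3 where "e3 = r *\<^sub>R e' + (pb - sb) *\<^sub>R e"
    have B3: "eigen (A k) e' \<or> eigen (A k) e3" if "k \<in> {1..m}" for k
      unfolding e3_def using shared_eigenvector[OF e'e B' _ det'[OF b(1) that]] B
      by (simp add: add.commute)
    have be3: "eigen (A b) e3"
      unfolding eigen_def e3_def
      by (rule exI[of _ pb]) (simp add: B B' matrix_vector_right_distrib matrix_vector_mult_scaleR algebra_simps)
    have ce3: "eigen (A c) e3" using B3 c by blast
    have "pb \<noteq> sb" using ce3 c(2) r by (auto simp: e3_def eigen_scaleR)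
    have ee3: "cross2 e e3 \<noteq> 0"
      using cross2_expand[of 1 e 0 e' "pb - sb" r] r ee' by (simp add: e3_def add.commute)
    have e'e3: "cross2 e' e3 \<noteq> 0"
      using cross2_expand[of 1 e' 0 e r "pb - sb"] \<open>pb \<noteq> sb\<close> e'e by (simp add: e3_def)
    obtain t where C3: "A c *v e3 = t *\<^sub>R e3" using ce3 by (auto simp: eigen_def)
    have "pc \<noteq> t"
    proof
      assume "pc = t"
      obtain \<alpha> \<beta> where "e' = \<alpha> *\<^sub>R e + \<beta> *\<^sub>R e3" using cross2_basis[OF ee3] .
      then have "A c *v e' = t *\<^sub>R e'"
        by (simp add: C C3 \<open>pc = t\<close> matrix_vector_right_distrib matrix_vector_mult_scaleR algebra_simps)
      with c(2) show False by (auto simp: eigen_def)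
    qed
    have C_or: "eigen (A k) e \<or> eigen (A k) e3" if "k \<in> {1..m}" for k
      using eigen_dichotomy[OF ee3 C C3 \<open>pc \<noteq> t\<close> det'[OF c(1) that]] .
    have two: "(eigen (A k) e \<and> eigen (A k) e') \<or> (eigen (A k) e' \<and> eigen (A k) e3) \<or>
        (eigen (A k) e \<and> eigen (A k) e3)" if "k \<in> {1..m}" for k
      using e_or_e' B3 C_or that by blast
    have ab: "commutator (A a) (A b) \<noteq> 0"
    proof
      assume "commutator (A a) (A b) = 0"
      then have "cross2 e (commutator (A a) (A b) *v e) = 0" by simp
      also have "commutator (A a) (A b) *v e = 0 *\<^sub>R e + (r * (s - p)) *\<^sub>R e'"
        by (simp add: commutator_mult e Ae' B matrix_vector_right_distrib matrix_vector_mult_scaleR algebra_simps)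
      finally show False using r \<open>s \<noteq> p\<close> ee' by simp
    qed
    have ac: "commutator (A a) (A c) \<noteq> 0"
    proof
      assume "commutator (A a) (A c) = 0"
      then have "cross2 (commutator (A a) (A c) *v e') e' = 0" by simp
      also have "commutator (A a) (A c) *v e' = (qc * (p - s)) *\<^sub>R e"
        by (simp add: commutator_mult e Ae' C' matrix_vector_right_distrib matrix_vector_mult_scaleR algebra_simps)
      finally show False using qc \<open>s \<noteq> p\<close> ee' by simp
    qed
    have bc: "commutator (A b) (A c) \<noteq> 0"
    proof
      assume "commutator (A b) (A c) = 0"
      then have "cross2 (1 *\<^sub>R e + 0 *\<^sub>R e') (commutator (A b) (A c) *v e') = 0" by simp
      also have "commutator (A b) (A c) *v e' = (qc * (pb - sb)) *\<^sub>R e + (qc * r) *\<^sub>R e'"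
        by (simp add: commutator_mult B B' C' matrix_vector_right_distrib matrix_vector_mult_scaleR algebra_simps)
      finally show False unfolding cross2_expand using qc r ee' by simp
    qed
    have ne: "commutator (A j) (A k) \<noteq> 0 \<Longrightarrow> commutator (A k) (A j) \<noteq> 0 \<and> j \<noteq> k" for j k
      using commutator_swap[of "A j" "A k"] by (auto simp: commutator_def)
    have red: "reduced A {a, b, c}" unfolding reduced_def using ab ac bc ne by blast
    have "reduced_length A m = 3" "maximal_reduction A m {a, b, c}"
      using triangle_reduced_length[OF a(1) b(1) c(1) red _ _ _ ee' e'e3 ee3 two] ab ac bc ne by blast+
    from trace[OF this, of a b c] trace_ne show False by simp
  qed
qed

section \<open>Triangular coordinates and conclusion\<close>

lemma Carleman_linear_image:
  fixes M N :: "complex^2^2"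
  assumes S: "allows_Carleman_approximation S" and MN: "M ** N = mat 1" "N ** M = mat 1"
  shows "allows_Carleman_approximation ((*v) M ` S)"
proof -
  have inv: "M *v (N *v p) = p" "N *v (M *v p) = p" for p
    by (simp_all add: matrix_vector_mul_assoc MN)
  have cont: "continuous_on X ((*v) K)" for X and K :: "complex^2^2"
    unfolding matrix_vector_mult_def by (intro continuous_intros)
  have "(*v) M ` S = (*v) N -` S"
    using inv by (auto simp: image_iff) (metis inv(1))
  moreover have "closed ((*v) N -` S)"
    using S cont[of UNIV N] by (intro closed_vimage) (auto simp: allows_Carleman_approximation_def)
  moreover have "\<exists>g. entire g \<and> (\<forall>p\<in>(*v) M ` S. cmod (f p - g p) < \<epsilon> p)"
    if f: "continuous_on ((*v) M ` S) f" and \<epsilon>: "continuous_on ((*v) M ` S) \<epsilon>" "\<forall>p\<in>(*v) M ` S. 0 < \<epsilon> p" 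
    for f \<epsilon>
  proof -
    have "continuous_on S (\<lambda>p. f (M *v p))" "continuous_on S (\<lambda>p. \<epsilon> (M *v p))"
      using f \<epsilon>(1) by (auto intro: continuous_on_compose2 cont)
    moreover have "\<forall>p\<in>S. 0 < \<epsilon> (M *v p)" using \<epsilon>(2) by blast
    ultimately obtain g where g: "entire g" "\<forall>p\<in>S. cmod (f (M *v p) - g p) < \<epsilon> (M *v p)"
      using S unfolding allows_Carleman_approximation_def
      by (elim conjE allE[of _ "\<lambda>p. f (M *v p)"] allE[of _ "\<lambda>p. \<epsilon> (M *v p)"]) auto
    show ?thesis
      by (rule exI[of _ "\<lambda>p. g (N *v p)"]) (use g(2) in \<open>auto simp: inv intro: entire_compose_matrix g(1)\<close>)
  qed
  ultimately show ?thesis unfolding allows_Carleman_approximation_def by auto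
qed

lemma (in triangular_planes) planes_allow_Carleman_approximation:
  "allows_Carleman_approximation planes"
proof -
  obtain C where C: "C \<ge> 1" "\<And>r R h. \<lbrakk>r > 0; continuous_on planes h;
      \<And>p. \<lbrakk>p \<in> planes; norm p \<le> C * r\<rbrakk> \<Longrightarrow> h p = 0\<rbrakk> \<Longrightarrow>
    entire_approximable (window r R) (\<lambda>p. if p \<in> planes then h p else 0)"
    using approximation_away_from_origin by blast
  show ?thesis
  proof (rule Carleman_approximation_if_local[OF closed_planes C(1)])
    fix r R \<delta> :: real and h :: "complex^2 \<Rightarrow> complex"
    assume r: "r > 0" "\<delta> > 0" and h: "continuous_on planes h"
      "\<And>p. \<lbrakk>p \<in> planes; norm p \<le> C * r\<rbrakk> \<Longrightarrow> h p = 0"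
    obtain g where g: "entire g" "\<And>p. p \<in> window r R \<Longrightarrow> cmod ((if p \<in> planes then h p else 0) - g p) < \<delta>"
      using C(2)[OF r(1) h, of R] r(2) unfolding entire_approximable_def by blast
    show "\<exists>g. entire g \<and> (\<forall>p. norm p \<le> r \<longrightarrow> cmod (g p) < \<delta>) \<and>
        (\<forall>p\<in>planes. norm p \<le> R \<longrightarrow> cmod (h p - g p) < \<delta>)"
    proof (intro exI[of _ g] conjI allI impI ballI)
      fix p :: "complex^2" assume p: "norm p \<le> r"
      have "r * 1 \<le> C * r" using C(1) r(1) by simp
      then have "(if p \<in> planes then h p else 0) = 0" using h(2)[of p] p by simp
      then show "cmod (g p) < \<delta>" using g(2)[of p] p by (simp add: window_def)
    next
      fix p assume "p \<in> planes" "norm p \<le> R"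
      then show "cmod (h p - g p) < \<delta>" using g(2)[of p] by (simp add: window_def)
    qed (rule g(1))
  qed
qed

text \<open>The complexification of the real matrix with columns \<open>e\<close> and \<open>f\<close>.\<close>

definition columns2 :: "real^2 \<Rightarrow> real^2 \<Rightarrow> complex^2^2" where
  "columns2 e f = vector [vector [complex_of_real (e $ 1), complex_of_real (f $ 1)],
     vector [complex_of_real (e $ 2), complex_of_real (f $ 2)]]"

lemma columns2_mult:
  "(columns2 e f *v p) $ i = complex_of_real (e $ i) * p $ 1 + complex_of_real (f $ i) * p $ 2"
  using exhaust_2[of i] by (auto simp: columns2_def matrix_vector_mult_def sum_2)

lemma columns2_inverse:
  assumes "cross2 e f \<noteq> 0"
  obtains N where "columns2 e f ** N = mat 1" "N ** columns2 e f = mat 1"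
proof -
  have "det (columns2 e f) = complex_of_real (cross2 e f)"
    by (simp add: columns2_def det_2 cross2_def)
  then have "invertible (columns2 e f)" using assms by (simp add: invertible_det_nz)
  then show thesis using that by (auto simp: invertible_def)
qed

lemma tri_plane_eq_range:
  "tri_plane a b d = range (\<lambda>(s, t). vector [a * complex_of_real s + b * complex_of_real t, d * complex_of_real t])"
proof -
  have "p \<in> tri_plane a b d \<longleftrightarrow>
      (\<exists>s t. p = vector [a * complex_of_real s + b * complex_of_real t, d * complex_of_real t])" for p
    unfolding tri_plane_def by (simp add: vec_eq_iff forall_2)
  then show ?thesis by (auto simp: image_iff)
qed

lemma M_space_triangular:
  assumes ef: "cross2 e f \<noteq> 0" and A: "A *v e = a *\<^sub>R e" "A *v f = b *\<^sub>R e + d *\<^sub>R f"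
  shows "M_space A = (*v) (columns2 e f) ` tri_plane (complex_of_real a + \<i>) (complex_of_real b) (complex_of_real d + \<i>)"
proof -
  define pt :: "real \<Rightarrow> real \<Rightarrow> complex^2" where
    "pt s t = vector [(complex_of_real a + \<i>) * complex_of_real s + complex_of_real b * complex_of_real t,
       (complex_of_real d + \<i>) * complex_of_real t]" for s t
  have plane: "tri_plane (complex_of_real a + \<i>) (complex_of_real b) (complex_of_real d + \<i>) = range (\<lambda>(s, t). pt s t)"
    unfolding tri_plane_eq_range pt_def by simp
  have image: "(cmat A + mat \<i>) *v cvec x = (\<chi> i. complex_of_real ((A *v x) $ i) + \<i> * complex_of_real (x $ i))" for x
    by (simp add: vec_eq_iff forall_2 cmat_def cvec_def map_matrix_def mat_def matrix_vector_mult_def sum_2 algebra_simps)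
  have key: "(cmat A + mat \<i>) *v cvec (s *\<^sub>R e + t *\<^sub>R f) = columns2 e f *v pt s t" for s t
  proof -
    have "A *v (s *\<^sub>R e + t *\<^sub>R f) = (a * s + b * t) *\<^sub>R e + (d * t) *\<^sub>R f"
      by (simp add: A matrix_vector_right_distrib matrix_vector_mult_scaleR algebra_simps)
    then show ?thesis unfolding image
      by (simp add: vec_eq_iff columns2_mult pt_def algebra_simps)
  qed
  have "M_space A = (\<lambda>x. (cmat A + mat \<i>) *v cvec x) ` range (\<lambda>(s, t). s *\<^sub>R e + t *\<^sub>R f)"
    unfolding M_space_def cross2_span[OF ef] ..
  also have "\<dots> = (*v) (columns2 e f) ` range (\<lambda>(s, t). pt s t)"
    by (simp add: image_image case_prod_unfold key)
  finally show ?thesis by (simp add: plane)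
qed

lemma real_plane_triangular:
  assumes ef: "cross2 e f \<noteq> 0"
  shows "real_plane = (*v) (columns2 e f) ` tri_plane 1 0 1"
proof -
  define pt :: "real \<Rightarrow> real \<Rightarrow> complex^2" where
    "pt s t = vector [complex_of_real s, complex_of_real t]" for s t
  have plane: "tri_plane 1 0 1 = range (\<lambda>(s, t). pt s t)"
    unfolding tri_plane_eq_range pt_def by simp
  have key: "cvec (s *\<^sub>R e + t *\<^sub>R f) = columns2 e f *v pt s t" for s t
    by (simp add: vec_eq_iff columns2_mult pt_def cvec_def algebra_simps)
  have "real_plane = cvec ` range (\<lambda>(s, t). s *\<^sub>R e + t *\<^sub>R f)"
    unfolding real_plane_def cross2_span[OF ef] ..
  also have "\<dots> = (*v) (columns2 e f) ` range (\<lambda>(s, t). pt s t)"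
    by (simp add: image_image case_prod_unfold key)
  finally show ?thesis by (simp add: plane)
qed

text \<open>The imaginary part of \<open>(A + i) x\<close> is \<open>x\<close>, so a common point of the two spaces has the same \<open>x\<close> in both
  parametrizations.\<close>

lemma difference_injective_if_transversal:
  assumes "M_space A \<inter> M_space B = {0}" "A *v x = B *v x"
  shows "x = 0"
proof -
  define p where "p = (cmat A + mat \<i>) *v cvec x"
  have p: "(cmat B + mat \<i>) *v cvec x = p"
    using assms(2)
    unfolding p_def by (simp add: vec_eq_iff forall_2 cmat_def cvec_def map_matrix_def mat_def 
        matrix_vector_mult_def sum_2 algebra_simps flip: of_real_mult of_real_add)
  have "p \<in> M_space A" unfolding M_space_def p_def by blast
  moreover have "p \<in> M_space B" unfolding M_space_def using p by blast
  ultimately have "p = 0" using assms(1) by blast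
  moreover have "Im (p $ i) = x $ i" for i
    using exhaust_2[of i]
    by (auto simp: p_def cmat_def cvec_def map_matrix_def mat_def matrix_vector_mult_def sum_2)
  ultimately show ?thesis by (simp add: vec_eq_iff)
qed

lemma real_plus_i_ratio_nonreal:
  assumes "x \<noteq> y"
  shows "(complex_of_real x + \<i>) / (complex_of_real y + \<i>) \<notin> \<real>"
proof
  assume "(complex_of_real x + \<i>) / (complex_of_real y + \<i>) \<in> \<real>"
  then obtain t where "(complex_of_real x + \<i>) / (complex_of_real y + \<i>) = complex_of_real t"
    by (auto elim: Reals_cases)
  moreover have "complex_of_real y + \<i> \<noteq> 0" by (simp add: complex_eq_iff)
  ultimately have "complex_of_real x + \<i> = complex_of_real t * (complex_of_real y + \<i>)"
    by (simp add: divide_eq_eq)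
  then show False using assms by (auto simp: complex_eq_iff)
qed

theorem corollary1p4:
  fixes A :: "nat \<Rightarrow> real^2^2" and m :: nat
  assumes "1 \<le> m"
    and "\<And>j k. j \<in> {1..m} \<Longrightarrow> k \<in> {1..m} \<Longrightarrow> j \<noteq> k \<Longrightarrow> M_space (A j) \<inter> M_space (A k) = {0}"
    and "\<And>j. j \<in> {1..m} \<Longrightarrow> spec (A j) \<subseteq> \<real>"
    and "\<And>j k. 1 \<le> j \<Longrightarrow> j < k \<Longrightarrow> k \<le> m \<Longrightarrow> det (commutator (A j) (A k)) = 0"
    and "\<And>I a b c. reduced_length A m = 3 \<Longrightarrow> maximal_reduction A m I \<Longrightarrow>
           a \<in> I \<Longrightarrow> b \<in> I \<Longrightarrow> c \<in> I \<Longrightarrow>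
           trace (A a ** A b ** A c - A c ** A b ** A a) = 0"
  shows "allows_Carleman_approximation ((\<Union>j\<in>{1..m}. M_space (A j)) \<union> real_plane)"
proof -
  have "\<exists>e. e \<noteq> 0 \<and> (\<forall>j\<in>{1..m}. eigen (A j) e)"
    by (rule common_eigenvector[OF assms(3,4,5)]) auto
  then obtain e where e: "e \<noteq> 0" "\<And>j. j \<in> {1..m} \<Longrightarrow> eigen (A j) e" by blast
  obtain f where ef: "cross2 e f \<noteq> 0" using cross2_complement[OF e(1)] .
  have "\<exists>abd. A j *v e = fst abd *\<^sub>R e \<and> A j *v f = fst (snd abd) *\<^sub>R e + snd (snd abd) *\<^sub>R f"
    if j: "j \<in> {1..m}" for j
  proof -
    obtain a where a: "A j *v e = a *\<^sub>R e" using e(2)[OF j] by (auto simp: eigen_def)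
    obtain b d where bd: "A j *v f = b *\<^sub>R e + d *\<^sub>R f" using cross2_basis[OF ef] .
    show ?thesis by (rule exI[of _ "(a, b, d)"]) (simp add: a bd)
  qed
  then have "\<exists>abd. \<forall>j\<in>{1..m}. A j *v e = fst (abd j) *\<^sub>R e \<and> A j *v f = fst (snd (abd j)) *\<^sub>R e + snd (snd (abd j)) *\<^sub>R f"
    by (intro bchoice ballI)
  then obtain abd where abd: "\<forall>j\<in>{1..m}. A j *v e = fst (abd j) *\<^sub>R e \<and> A j *v f = fst (snd (abd j)) *\<^sub>R e + snd (snd (abd j)) *\<^sub>R f" ..
  define a b d where "a j = fst (abd j)" and "b j = fst (snd (abd j))" and "d j = snd (snd (abd j))" for j
  have Ae: "A j *v e = a j *\<^sub>R e" and Af: "A j *v f = b j *\<^sub>R e + d j *\<^sub>R f" if "j \<in> {1..m}" for j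
    using abd that by (simp_all add: a_def b_def d_def)
  have e0: "e \<noteq> 0" by fact
  have ne: "a j \<noteq> a k \<and> d j \<noteq> d k" if j: "j \<in> {1..m}" and k: "k \<in> {1..m}" and "j \<noteq> k" for j k
  proof -
    note inj = difference_injective_if_transversal[OF assms(2)[OF j k \<open>j \<noteq> k\<close>]]
    have aa: "a j \<noteq> a k" using inj[of e] e0 Ae j k by auto
    have "d j \<noteq> d k"
    proof
      assume dd: "d j = d k"
      \<comment> \<open>With equal lower diagonal entries the difference \<open>A j - A k\<close> would be singular, with \<open>t e + f\<close> in its kernel.\<close>
      define t where "t = (b k - b j) / (a j - a k)"
      have t: "t * a j + b j = t * a k + b k" using aa by (simp add: t_def field_simps)
      have "A i *v (t *\<^sub>R e + f) = (t * a i + b i) *\<^sub>R e + d i *\<^sub>R f" if "i \<in> {1..m}" for i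
        using Ae[OF that] Af[OF that] by (simp add: matrix_vector_right_distrib matrix_vector_mult_scaleR algebra_simps)
      then have "t *\<^sub>R e + f = 0" using inj[of "t *\<^sub>R e + f"] j k dd t by simp
      then have "cross2 (t *\<^sub>R e + 1 *\<^sub>R f) (- 1 *\<^sub>R e + 0 *\<^sub>R f) = 0" by simp
      then show False unfolding cross2_expand using ef by simp
    qed
    with aa show ?thesis by blast
  qed
  \<comment> \<open>The index 0 stands for \<open>\<real>\<^sup>2\<close>.\<close>
  define \<alpha> \<beta> \<delta> where "\<alpha> j = (if j = 0 then 1 else complex_of_real (a j) + \<i>)"
    and "\<beta> j = (if j = 0 then 0 else complex_of_real (b j))"
    and "\<delta> j = (if j = 0 then 1 else complex_of_real (d j) + \<i>)" for j :: nat
  interpret triangular_planes "{0..m}" \<alpha> \<beta> \<delta>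
  proof
    show "\<alpha> j \<noteq> 0" "\<delta> j \<noteq> 0" for j by (auto simp: \<alpha>_def \<delta>_def complex_eq_iff)
    fix j k assume jk: "j \<in> {0..m}" "k \<in> {0..m}" "j \<noteq> k"
    have real_i: "complex_of_real x + \<i> \<notin> \<real>" "1 / (complex_of_real x + \<i>) \<notin> \<real>" for x
      by (simp_all add: complex_is_Real_iff Im_divide power2_eq_square add_nonneg_eq_0_iff)
    show "\<alpha> k / \<alpha> j \<notin> \<real>" "\<delta> k / \<delta> j \<notin> \<real>"
      using jk ne[of k j] real_i by (auto simp: \<alpha>_def \<delta>_def intro!: real_plus_i_ratio_nonreal)
  qed simp
  have "(\<Union>j\<in>{1..m}. M_space (A j)) \<union> real_plane = (*v) (columns2 e f) ` planes"
  proof -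
    have "M_space (A j) = (*v) (columns2 e f) ` plane j" if "j \<in> {1..m}" for j
      using M_space_triangular[OF ef Ae[OF that] Af[OF that]] that by (simp add: \<alpha>_def \<beta>_def \<delta>_def)
    moreover have "real_plane = (*v) (columns2 e f) ` plane 0"
      using real_plane_triangular[OF ef] by (simp add: \<alpha>_def \<beta>_def \<delta>_def)
    moreover have "planes = plane 0 \<union> (\<Union>j\<in>{1..m}. plane j)"
    proof -
      have "{0..m} = insert 0 {1..m}" by auto
      then show ?thesis unfolding planes_def by (simp only: UN_insert)
    qed
    ultimately show ?thesis by (simp add: image_Un image_UN Un_commute)
  qed
  moreover obtain N where "columns2 e f ** N = mat 1" "N ** columns2 e f = mat 1"
    using columns2_inverse[OF ef] .
  ultimately show ?thesis
    using Carleman_linear_image[OF planes_allow_Carleman_approximation] by simp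
qed

end
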